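(* Let $n\ge 1$ and $k\ge 1$ be positive integers. If $A\subset[0,1]^n$ is a $k$-antichain in $[0,1]^n$, then \[ \mathcal{H}^{n-1}(A)\le kn . \]
   Context: For $\mathbf{x}=(x_1,\ldots,x_n)$ and $\mathbf{y}=(y_1,\ldots,y_n)$ in $\mathbb{R}^n$, write $\mathbf{x}\le\mathbf{y}$ if $x_i\le y_i$ for all $i\in\{1,\ldots,n\}$. For $S\subset\mathbb{R}^n$, a set $C\subset S$ is a chain in $S$ if for all $\mathbf{x},\mathbf{y}\in C$ either $\mathbf{x}\le\mathbf{y}$ or $\mathbf{y}\le\mathbf{x}$. For a positive integer $k$, a $k$-antichain in $S$ is a set $A\subset S$ such that $A\cap C$ has at most $k$ elements for every chain $C\subset S$. $\mathcal{H}^s$ denotes the $s$-dimensional Hausdorff outer measure with respect to the Euclidean metric, in the standard normalization of Evans and Gariepy: $\mathcal{H}^s(A)=\lim_{\delta\to0^+}\inf\{\sum_j \alpha(s)(\operatorname{diam}C_j/2)^s : A\subset\bigcup_j C_j,\ \operatorname{diam}C_j\le\delta\}$ with $\alpha(s)=\pi^{s/2}/\Gamma(s/2+1)$. In particular, $\mathcal{H}^0$ is counting measure and $\mathcal{H}^{m}$ agrees with Lebesgue measure on $\mathbb{R}^{m}$ for positive integers $m$. No measurability of $A$ is assumed. *)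

theory Defs
  imports "HOL-Analysis.Analysis"
begin

(* Weight alpha(s) * (diam C / 2)^s of a covering set, where unit_ball_vol s = alpha(s).
   For s = 0 the convention is 0^0 = 1 on nonempty sets and weight 0 on the empty set, so that
   H^0 is counting measure; this is why powr (where 0 powr 0 = 0) is not used there. *)
definition hausdorff_weight :: "real \<Rightarrow> 'a::metric_space set \<Rightarrow> ennreal" where
  "hausdorff_weight s C =
     (if C = {} then 0
      else ennreal (unit_ball_vol s * (if s = 0 then 1 else (diameter C / 2) powr s)))"

(* The boundedness requirement is part of "diam C_j \<le> \<delta>": the real-valued diameter is
   meaningless on unbounded sets. *)
definition hausdorff_premeasure :: "real \<Rightarrow> real \<Rightarrow> 'a::metric_space set \<Rightarrow> ennreal" where
  "hausdorff_premeasure s \<delta> A =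
     (INF C \<in> {C :: nat \<Rightarrow> 'a set. A \<subseteq> (\<Union>j. C j) \<and> (\<forall>j. bounded (C j) \<and> diameter (C j) \<le> \<delta>)}.
        \<Sum>j. hausdorff_weight s (C j))"

definition hausdorff_measure :: "real \<Rightarrow> 'a::metric_space set \<Rightarrow> ennreal" where
  "hausdorff_measure s A = Lim (at_right 0) (\<lambda>\<delta>. hausdorff_premeasure s \<delta> A)"

definition k_antichain :: "nat \<Rightarrow> 'a::ord set \<Rightarrow> 'a set \<Rightarrow> bool" where
  "k_antichain k S A \<longleftrightarrow>
     A \<subseteq> S \<and>
     (\<forall>C. C \<subseteq> S \<and> Complete_Partial_Order.chain (\<le>) C \<longrightarrow> finite (A \<inter> C) \<and> card (A \<inter> C) \<le> k)"

lemma hausdorff_premeasure_antimono: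
  assumes "\<delta> \<le> \<epsilon>"
  shows "hausdorff_premeasure s \<epsilon> A \<le> hausdorff_premeasure s \<delta> A"
  unfolding hausdorff_premeasure_def
  using assms by (intro INF_superset_mono) (auto intro: order_trans)

lemma hausdorff_premeasure_tendsto:
  "((\<lambda>\<delta>. hausdorff_premeasure s \<delta> A) \<longlongrightarrow> (SUP \<delta>\<in>{0<..}. hausdorff_premeasure s \<delta> A)) (at_right 0)"
proof (rule order_tendstoI)
  fix a assume "a < (SUP \<delta>\<in>{0<..}. hausdorff_premeasure s \<delta> A)"
  then obtain e where e: "e > 0" "a < hausdorff_premeasure s e A"
    by (auto simp: less_SUP_iff)
  then show "\<forall>\<^sub>F \<delta> in at_right 0. a < hausdorff_premeasure s \<delta> A"
    unfolding eventually_at_right_field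
    by (intro exI[of _ e]) (auto intro: less_le_trans[OF _ hausdorff_premeasure_antimono[OF less_imp_le]])
next
  fix a assume a: "(SUP \<delta>\<in>{0<..}. hausdorff_premeasure s \<delta> A) < a"
  have "hausdorff_premeasure s \<delta> A < a" if "\<delta> > 0" for \<delta>
    using that by (intro le_less_trans[OF _ a] SUP_upper) auto
  then show "\<forall>\<^sub>F \<delta> in at_right 0. hausdorff_premeasure s \<delta> A < a"
    unfolding eventually_at_right_field by (intro exI[of _ 1]) auto
qed

lemma hausdorff_measure_eq_SUP:
  "hausdorff_measure s A = (SUP \<delta>\<in>{0<..}. hausdorff_premeasure s \<delta> A)"
  unfolding hausdorff_measure_def
  by (intro tendsto_Lim hausdorff_premeasure_tendsto) simp

end

(* A k-antichain is a union of k antichains, so it suffices to bound one antichain A by n.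
   Let F x be the largest t such that x + t(1,...,1) lies below some point of A. Then F is antitone,
   1-Lipschitz and decreases at unit speed along the diagonal, and A lies in the surface F = 0. At a
   point where F is differentiable this surface has a normal \<nu> with nonnegative entries, whose sum is
   at least |\<nu>| = 1. Hence the projections of a small ball of the surface to the n coordinate
   hyperplanes have total area at least (1 - \<eta>) times the area of a flat disc of the same radius.
   The projections of disjoint pieces overlap only in null sets, so each coordinate hyperplane
   contributes total area at most 1, and a Vitali covering by such balls bounds the Hausdorff measure
   by n. The points where F is not differentiable are negligible by Rademacher's theorem. *)
theory Submission
  imports Defs
begin

section \<open>Lipschitz functions are differentiable almost everywhere\<close>

text \<open>The set \<open>A\<close> may be nonmeasurable, so no volume of \<open>A\<close> or of
  its projections is ever formed: volumes are taken of pieces of the closed surface that contains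
  \<open>A\<close>, and \<open>A\<close> enters only through covers.

  The weight of a ball in the Hausdorff measure equals the volume of a flat disc of the same radius.
  Hence comparing small balls of the surface with flat discs loses no factor, and the covering
  argument must not lose one either, which rules out enlarging all balls of a Vitali family.

  The main obstacle is the exceptional set. Rademacher's theorem makes it null for n-dimensional
  volume, whereas its trace on the surface has to be null for the (n-1)-dimensional measure. The gap
  is bridged by the diagonal: \<open>F\<close> differs from its diagonal translates only by
  constants, so the exceptional set is a union of whole diagonal lines, and an n-dimensional volume
  around it controls an (n-1)-dimensional cross-section.\<close>

text \<open>In dimension one the closed balls of the Vitali covering theorem are intervals. The
  condition speaks of the interval between \<open>x\<close> and \<open>x + t\<close> because over it
  a slope at \<open>x\<close> is a ratio of increments.\<close>

lemma Vitali_covering_intervals: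
  fixes E U :: "real set"
  assumes "open U" "E \<subseteq> U"
    and P: "\<And>x d. x \<in> E \<Longrightarrow> d > 0 \<Longrightarrow>
      \<exists>t. t \<noteq> 0 \<and> \<bar>t\<bar> < d \<and> P (min x (x + t)) (max x (x + t))"
  obtains C where "countable C" "\<And>a b. (a, b) \<in> C \<Longrightarrow> a < b \<and> {a..b} \<subseteq> U \<and> P a b"
    "disjoint_family_on (\<lambda>(a, b). {a..b}) C" "negligible (E - (\<Union>(a, b)\<in>C. {a..b}))"
proof -
  define K where "K = {(a, b). a < b \<and> {a..b} \<subseteq> U \<and> P a b}"
  define c where "c = (\<lambda>(a, b). (a + b) / 2 :: real)"
  define r where "r = (\<lambda>(a, b). (b - a) / 2 :: real)"
  have cball: "cball (c (a, b)) (r (a, b)) = {a..b}" for a b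
    by (simp add: c_def r_def cball_eq_atLeastAtMost field_simps)
  obtain C where C: "countable C" "C \<subseteq> K"
     "pairwise (\<lambda>i j. disjnt (cball (c i) (r i)) (cball (c j) (r j))) C"
     "negligible (E - (\<Union>i \<in> C. cball (c i) (r i)))"
  proof (rule Vitali_covering_theorem_cballs[of K r E c])
    show "0 < r i" if "i \<in> K" for i
      using that by (auto simp: K_def r_def)
  next
    fix x d :: real assume "x \<in> E" "0 < d"
    with assms obtain e where e: "e > 0" "cball x e \<subseteq> U"
      by (meson open_contains_cball subset_iff)
    obtain t where t: "t \<noteq> 0" "\<bar>t\<bar> < min d e" "P (min x (x + t)) (max x (x + t))"
      using P[of x "min d e"] \<open>x \<in> E\<close> \<open>0 < d\<close> e by auto
    have sub: "{min x (x + t)..max x (x + t)} \<subseteq> cball x e"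
      using t by (auto simp: cball_eq_atLeastAtMost)
    let ?i = "(min x (x + t), max x (x + t))"
    have "?i \<in> K"
      using t sub e by (auto simp: K_def)
    moreover have "x \<in> cball (c ?i) (r ?i)"
      unfolding cball by auto
    moreover have "r ?i < d"
      using t \<open>0 < d\<close> by (auto simp: r_def)
    ultimately show "\<exists>i. i \<in> K \<and> x \<in> cball (c i) (r i) \<and> r i < d"
      by blast
  qed
  have *: "cball (c i) (r i) = (\<lambda>(a, b). {a..b}) i" for i
    using cball[of "fst i" "snd i"] by (simp add: case_prod_beta)
  show ?thesis
  proof
    show "countable C" by fact
    show "a < b \<and> {a..b} \<subseteq> U \<and> P a b" if "(a, b) \<in> C" for a b
      using that C(2) by (auto simp: K_def)
    show "disjoint_family_on (\<lambda>(a, b). {a..b}) C"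
      using C(3) by (simp add: * pairwise_def disjoint_family_on_def disjnt_def)
    show "negligible (E - (\<Union>(a, b)\<in>C. {a..b}))"
      using C(4) by (simp add: *)
  qed
qed

lemma negligible_if_countable:
  fixes S :: "'a::euclidean_space set"
  shows "countable S \<Longrightarrow> negligible S"
  using countable_imp_null_set_lborel[of S] null_sets_completionI negligible_iff_null_sets by blast

text \<open>It is a countable intersection of open sets: \<open>d\<close> may be restricted to the
  values 1/(n+1), and for fixed nonzero \<open>t\<close> the slope is continuous in
  \<open>x\<close>.\<close>

lemma slope_set_Borel:
  fixes f :: "'a::real_normed_vector \<Rightarrow> real"
  assumes "continuous_on UNIV f"
  shows "{x. \<forall>d>0. \<exists>t. t \<noteq> 0 \<and> \<bar>t\<bar> < d \<and> (f (x + t *\<^sub>R e) - f x) / t < u} \<in> sets borel" (is "?A \<in> _")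
proof -
  have eq: "?A = (\<Inter>n. \<Union>t\<in>{t. t \<noteq> 0 \<and> \<bar>t\<bar> < inverse (Suc n)}. {x. (f (x + t *\<^sub>R e) - f x) / t < u})"
  proof (intro equalityI subsetI)
    fix x assume x: "x \<in> (\<Inter>n. \<Union>t\<in>{t. t \<noteq> 0 \<and> \<bar>t\<bar> < inverse (Suc n)}. {x. (f (x + t *\<^sub>R e) - f x) / t < u})"
    show "x \<in> ?A"
    proof (clarify)
      fix d :: real assume "d > 0"
      then obtain n where "inverse (Suc n) < d" using reals_Archimedean by blast
      with x show "\<exists>t. t \<noteq> 0 \<and> \<bar>t\<bar> < d \<and> (f (x + t *\<^sub>R e) - f x) / t < u"
        by (clarsimp simp: INT_iff) (smt (verit, ccfv_SIG))
    qed
  qed auto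
  have "open {x. (f (x + t *\<^sub>R e) - f x) / t < u}" if "t \<noteq> 0" for t
    by (intro open_Collect_less continuous_intros continuous_on_compose2[OF assms]) (auto simp: that)
  then have "(\<Union>t\<in>{t. t \<noteq> 0 \<and> \<bar>t\<bar> < inverse (Suc n)}. {x. (f (x + t *\<^sub>R e) - f x) / t < u}) \<in> sets borel" for n
    by (intro borel_open open_UN) auto
  then show ?thesis
    unfolding eq by (intro sets.countable_INT') auto
qed

text \<open>This is the covering argument behind Lebesgue's theorem on monotone functions. Cover
  \<open>F\<close> by intervals of slope below \<open>u\<close> inside an open set barely larger
  than \<open>F\<close>; inside these, cover \<open>F\<close> again by intervals of slope above
  \<open>v\<close>. The increments of \<open>f\<close> over the second family are at most those over
  the first, so the volume m of \<open>F\<close> satisfies \<open>v * m \<le> u * (m + e)\<close>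
  for every \<open>e > 0\<close>.\<close>

lemma negligible_slope_gap_aux:
  fixes f :: "real \<Rightarrow> real"
  assumes "mono f" and cont: "continuous_on UNIV f" and u: "0 < u" and "u < v"
    and F: "F \<in> sets borel" and Ffin: "emeasure lborel F < \<infinity>"
    and lower: "\<And>x d. x \<in> F \<Longrightarrow> d > 0 \<Longrightarrow> \<exists>t. t \<noteq> 0 \<and> \<bar>t\<bar> < d \<and> (f (x + t) - f x) / t < u"
    and upper: "\<And>x d. x \<in> F \<Longrightarrow> d > 0 \<Longrightarrow> \<exists>t. t \<noteq> 0 \<and> \<bar>t\<bar> < d \<and> (f (x + t) - f x) / t > v"
  shows "negligible F"
proof -
  have slope: "(f (max x (x + t)) - f (min x (x + t))) / (max x (x + t) - min x (x + t)) = (f (x + t) - f x) / t"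
    if "t \<noteq> 0" for x t
    using that by (cases "t > 0") (auto simp: max_def min_def field_simps)
  \<comment> \<open>The Stieltjes measure of \<open>f\<close> turns total increments over disjoint
    intervals into measures of unions, so that the two families are compared by monotonicity of a
    measure.\<close>
  define M where "M = interval_measure f"
  have M: "emeasure M {a<..b} = ennreal (f b - f a)" if "a \<le> b" for a b
    unfolding M_def
  proof (rule emeasure_interval_measure_Ioc[OF that])
    show "f x \<le> f y" if "x \<le> y" for x y using \<open>mono f\<close> that by (auto dest: monoD)
    show "continuous (at_right a) f" for a
      using cont by (meson UNIV_I continuous_at_imp_continuous_at_within continuous_on_eq_continuous_at open_UNIV)
  qed
  have setsM: "sets M = sets borel" by (simp add: M_def)
  note [simp] = setsM
  define W where "W = (\<lambda>C. \<Union>(a, b)\<in>C. {a<..b::real})"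
  have WM: "emeasure N (W C) = (\<integral>\<^sup>+i. emeasure N {fst i<..snd i} \<partial>count_space C)"
    if "countable C" "disjoint_family_on (\<lambda>(a, b). {a..b}) C" "sets N = sets borel" for N C
  proof -
    have "disjoint_family_on (\<lambda>i. {fst i<..snd i}) C"
      unfolding disjoint_family_on_def
    proof (intro ballI impI)
      fix i j assume "i \<in> C" "j \<in> C" "i \<noteq> j"
      then have "{fst i..snd i} \<inter> {fst j..snd j} = {}"
        using that(2) by (auto simp: disjoint_family_on_def case_prod_beta)
      then show "{fst i<..snd i} \<inter> {fst j<..snd j} = {}"
        by (meson disjoint_iff greaterThanAtMost_subseteq_atLeastAtMost_iff order_refl subset_eq)
    qed
    with that show ?thesis
      unfolding W_def case_prod_beta by (intro emeasure_UN_countable) auto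
  qed
  have key: "ennreal v * emeasure lborel F \<le> ennreal u * (emeasure lborel F + ennreal e)" if "e > 0" for e
  proof -
    have "F \<in> sets lebesgue" using F by auto
    then obtain U where U: "open U" "F \<subseteq> U" "(U - F) \<in> lmeasurable" "emeasure lebesgue (U - F) < ennreal e"
      using sets_lebesgue_outer_open[OF _ \<open>e > 0\<close>] by metis
    have "emeasure lborel U \<le> emeasure lborel F + emeasure lborel (U - F)"
      using U F by (subst plus_emeasure) (auto simp: Un_absorb1)
    also have "emeasure lborel (U - F) \<le> ennreal e"
      using U F by (simp add: less_imp_le)
    finally have Ue: "emeasure lborel U \<le> emeasure lborel F + ennreal e" by (simp add: add_left_mono)
    obtain C where C: "countable C" "\<And>a b. (a, b) \<in> C \<Longrightarrow> a < b \<and> {a..b} \<subseteq> U \<and> (f b - f a) / (b - a) < u"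
      "disjoint_family_on (\<lambda>(a, b). {a..b}) C" "negligible (F - (\<Union>(a, b)\<in>C. {a..b}))"
    proof (rule Vitali_covering_intervals[OF U(1,2), of "\<lambda>a b. (f b - f a) / (b - a) < u"])
      fix x d :: real assume "x \<in> F" "d > 0"
      then obtain t where "t \<noteq> 0" "\<bar>t\<bar> < d" "(f (x + t) - f x) / t < u" using lower by blast
      then show "\<exists>t. t \<noteq> 0 \<and> \<bar>t\<bar> < d \<and> (f (max x (x + t)) - f (min x (x + t))) / (max x (x + t) - min x (x + t)) < u"
        using slope by auto
    qed blast
    \<comment> \<open>Passing to open intervals drops only countably many end points and leaves an
      open set in which the second covering can take place.\<close>
    define V where "V = (\<Union>(a, b)\<in>C. {a<..<b})"
    have "open V" by (auto simp: V_def)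
    have "negligible (F - V)"
    proof (rule negligible_subset)
      show "negligible ((F - (\<Union>(a, b)\<in>C. {a..b})) \<union> (fst ` C \<union> snd ` C))"
        by (rule negligible_Un[OF C(4) negligible_if_countable]) (use C(1) in auto)
      show "F - V \<subseteq> (F - (\<Union>(a, b)\<in>C. {a..b})) \<union> (fst ` C \<union> snd ` C)"
      proof
        fix x assume x: "x \<in> F - V"
        show "x \<in> (F - (\<Union>(a, b)\<in>C. {a..b})) \<union> (fst ` C \<union> snd ` C)"
        proof (rule ccontr)
          assume "\<not> ?thesis"
          then obtain a b where "(a, b) \<in> C" "a \<le> x" "x \<le> b" "x \<notin> fst ` C" "x \<notin> snd ` C"
            using x by auto
          then have "a < x" "x < b" by (force simp: image_iff order.order_iff_strict)+
          with \<open>(a, b) \<in> C\<close> x show False by (auto simp: V_def)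
        qed
      qed
    qed
    obtain D where D: "countable D" "\<And>a b. (a, b) \<in> D \<Longrightarrow> a < b \<and> {a..b} \<subseteq> V \<and> (f b - f a) / (b - a) > v"
      "disjoint_family_on (\<lambda>(a, b). {a..b}) D" "negligible (F \<inter> V - (\<Union>(a, b)\<in>D. {a..b}))"
    proof (rule Vitali_covering_intervals[OF \<open>open V\<close>, of "F \<inter> V" "\<lambda>a b. (f b - f a) / (b - a) > v"])
      fix x d :: real assume "x \<in> F \<inter> V" "d > 0"
      then obtain t where "t \<noteq> 0" "\<bar>t\<bar> < d" "(f (x + t) - f x) / t > v" using upper by blast
      then show "\<exists>t. t \<noteq> 0 \<and> \<bar>t\<bar> < d \<and> (f (max x (x + t)) - f (min x (x + t))) / (max x (x + t) - min x (x + t)) > v"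
        using slope by auto
    qed auto
    have Wb: "W B \<in> sets borel" if "countable B" for B
      unfolding W_def using that by (intro sets.countable_UN') auto
    have "emeasure lborel F \<le> emeasure lborel (W D)"
    proof -
      have "negligible ((F - V) \<union> (F \<inter> V - (\<Union>(a, b)\<in>D. {a..b})) \<union> fst ` D)"
        by (rule negligible_Un[OF negligible_Un[OF \<open>negligible (F - V)\<close> D(4)] negligible_if_countable]) (use D(1) in auto)
      moreover have "F - W D \<subseteq> (F - V) \<union> (F \<inter> V - (\<Union>(a, b)\<in>D. {a..b})) \<union> fst ` D"
      proof
        fix x assume x: "x \<in> F - W D"
        show "x \<in> (F - V) \<union> (F \<inter> V - (\<Union>(a, b)\<in>D. {a..b})) \<union> fst ` D"
        proof (rule ccontr)
          assume "\<not> ?thesis"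
          then obtain a b where "(a, b) \<in> D" "a \<le> x" "x \<le> b" "x \<notin> fst ` D"
            using x by auto
          then have "a < x" by (force simp: image_iff order.order_iff_strict)+
          with \<open>(a, b) \<in> D\<close> \<open>x \<le> b\<close> x show False by (auto simp: W_def)
        qed
      qed
      ultimately have "negligible (F - W D)" by (rule negligible_subset)
      then have "emeasure lborel (F - W D) = 0"
        using F Wb[OF D(1)] by (auto simp: negligible_iff_null_sets null_sets_def)
      moreover have "emeasure lborel F \<le> emeasure lborel (W D \<union> (F - W D))"
        using F Wb[OF D(1)] by (intro emeasure_mono) auto
      moreover have "\<dots> \<le> emeasure lborel (W D) + emeasure lborel (F - W D)"
        using F Wb[OF D(1)] by (intro emeasure_subadditive) auto
      ultimately show ?thesis by (metis add.right_neutral order_trans)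
    qed
    then have "ennreal v * emeasure lborel F \<le> ennreal v * emeasure lborel (W D)"
      by (rule mult_left_mono) simp
    also have "\<dots> = (\<integral>\<^sup>+i. ennreal v * emeasure lborel {fst i<..snd i} \<partial>count_space D)"
      using D by (subst WM) (auto simp: nn_integral_cmult)
    also have "\<dots> \<le> (\<integral>\<^sup>+i. emeasure M {fst i<..snd i} \<partial>count_space D)"
    proof (rule nn_integral_mono)
      fix i assume "i \<in> space (count_space D)"
      then have "fst i < snd i" "(f (snd i) - f (fst i)) / (snd i - fst i) > v"
        using D(2)[of "fst i" "snd i"] by auto
      then show "ennreal v * emeasure lborel {fst i<..snd i} \<le> emeasure M {fst i<..snd i}"
        using u \<open>u < v\<close> by (auto simp: M less_imp_le field_simps simp flip: ennreal_mult intro!: ennreal_leI)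
    qed
    also have "\<dots> = emeasure M (W D)"
      using D by (subst WM) auto
    also have "\<dots> \<le> emeasure M (W C)"
    proof (rule emeasure_mono)
      show "W C \<in> sets M" using Wb[OF C(1)] by simp
      have "{a<..b} \<subseteq> V" if "(a, b) \<in> D" for a b
        using D(2)[OF that] by auto
      then have "W D \<subseteq> V"
        unfolding W_def by blast
      moreover have "V \<subseteq> W C"
        unfolding V_def W_def by (intro UN_mono) auto
      ultimately show "W D \<subseteq> W C" by blast
    qed
    also have "\<dots> = (\<integral>\<^sup>+i. emeasure M {fst i<..snd i} \<partial>count_space C)"
      using C by (subst WM) auto
    also have "\<dots> \<le> (\<integral>\<^sup>+i. ennreal u * emeasure lborel {fst i<..snd i} \<partial>count_space C)"
    proof (rule nn_integral_mono)
      fix i assume "i \<in> space (count_space C)"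
      then have "fst i < snd i" "(f (snd i) - f (fst i)) / (snd i - fst i) < u"
        using C(2)[of "fst i" "snd i"] by auto
      then show "emeasure M {fst i<..snd i} \<le> ennreal u * emeasure lborel {fst i<..snd i}"
        using u \<open>u < v\<close> by (auto simp: M less_imp_le field_simps simp flip: ennreal_mult intro!: ennreal_leI)
    qed
    also have "\<dots> = ennreal u * emeasure lborel (W C)"
      using C by (subst WM) (auto simp: nn_integral_cmult)
    also have "\<dots> \<le> ennreal u * emeasure lborel U"
    proof (intro mult_left_mono emeasure_mono)
      have "{a<..b} \<subseteq> U" if "(a, b) \<in> C" for a b
        using C(2)[OF that] by auto
      then show "W C \<subseteq> U" by (auto simp: W_def)
    qed (use U in auto)
    also have "\<dots> \<le> ennreal u * (emeasure lborel F + ennreal e)"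
      using Ue by (rule mult_left_mono) simp
    finally show ?thesis .
  qed
  define m where "m = measure lborel F"
  have m: "emeasure lborel F = ennreal m" "m \<ge> 0"
    using Ffin by (auto simp: m_def emeasure_eq_ennreal_measure)
  have "(v - u) * m / u \<le> 0 + e" if "e > 0" for e
  proof -
    have "v * m \<le> u * (m + e)"
      using key[OF that] u \<open>u < v\<close> m that by (auto simp flip: ennreal_mult ennreal_plus)
    then show ?thesis using u by (simp add: field_simps)
  qed
  then have "(v - u) * m / u \<le> 0" by (rule field_le_epsilon)
  with u \<open>u < v\<close> m have "m = 0" by (simp add: divide_le_0_iff mult_le_0_iff)
  with m have "emeasure lborel F = 0" by simp
  with F show ?thesis by (auto simp: negligible_iff_null_sets null_sets_def)
qed

text \<open>For \<open>u \<le> 0\<close> no slope of a monotone function lies below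
  \<open>u\<close>. For \<open>u > 0\<close> the set is cut by boxes into pieces of finite
  volume.\<close>

lemma negligible_slope_gap_mono:
  fixes f :: "real \<Rightarrow> real"
  assumes "mono f" and cont: "continuous_on UNIV f" and "u < v"
  shows "negligible {x. (\<forall>d>0. \<exists>t. t \<noteq> 0 \<and> \<bar>t\<bar> < d \<and> (f (x + t) - f x) / t < u) \<and>
                        (\<forall>d>0. \<exists>t. t \<noteq> 0 \<and> \<bar>t\<bar> < d \<and> (f (x + t) - f x) / t > v)}" (is "negligible ?E")
proof (cases "u > 0")
  case False
  have "(f (x + t) - f x) / t \<ge> 0" for x t
    using monoD[OF \<open>mono f\<close>, of x "x + t"] monoD[OF \<open>mono f\<close>, of "x + t" x]
    by (cases "0 < t") (auto simp: divide_nonpos_neg divide_nonpos_nonpos add.commute)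
  then have "\<not> (f (x + t) - f x) / t < u" for x t
    using False by (meson not_less order_trans)
  then have "?E = {}" using zero_less_one by blast
  then show ?thesis by (metis (lifting) negligible_empty)
next
  case u: True
  have "?E \<in> sets borel"
  proof -
    have "?E = {x. \<forall>d>0. \<exists>t. t \<noteq> 0 \<and> \<bar>t\<bar> < d \<and> (f (x + t *\<^sub>R 1) - f x) / t < u} \<inter>
               {x. \<forall>d>0. \<exists>t. t \<noteq> 0 \<and> \<bar>t\<bar> < d \<and> (- f (x + t *\<^sub>R 1) - - f x) / t < -v}"
    proof -
      have "(f b - f a) / t > v \<longleftrightarrow> (- f b - - f a) / t < -v" for a b t
        by (simp add: diff_divide_distrib) linarith
      then show ?thesis by (simp add: Collect_conj_eq)
    qed
    also have "\<dots> \<in> sets borel"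
      by (intro sets.Int slope_set_Borel cont continuous_on_minus)
    finally show ?thesis .
  qed
  have "negligible (?E \<inter> cbox a b)" for a b :: real
  proof (rule negligible_slope_gap_aux[OF \<open>mono f\<close> cont u \<open>u < v\<close>])
    show "?E \<inter> cbox a b \<in> sets borel" using \<open>?E \<in> sets borel\<close> by (intro sets.Int) auto
    have "emeasure lborel (?E \<inter> cbox a b) \<le> emeasure lborel (cbox a b)"
      by (intro emeasure_mono) auto
    then show "emeasure lborel (?E \<inter> cbox a b) < \<infinity>"
      using emeasure_lborel_cbox_finite le_less_trans by blast
  qed blast+
  then show ?thesis using negligible_on_intervals by blast
qed

section \<open>Null sets in several dimensions\<close>

text \<open>Integrate the indicator of \<open>x + t *\<^sub>R e \<in> S\<close> over
  \<open>t\<close> in the unit interval and over all \<open>x\<close>. By translation invariance one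
  order of integration gives the volume of \<open>S\<close>, and by hypothesis the other gives 0.
  This form of Fubini's theorem serves oblique directions \<open>e\<close> without a change of
  coordinates.\<close>

lemma negligible_if_negligible_on_lines:
  fixes S :: "'a::euclidean_space set"
  assumes [measurable]: "S \<in> sets borel"
    and line: "\<And>x. negligible {t. x + t *\<^sub>R e \<in> S}"
  shows "negligible S"
proof -
  define g where "g = (\<lambda>(t::real) x. indicator {0..1} t * indicator S (x + t *\<^sub>R e) :: ennreal)"
  have [measurable]: "(\<lambda>(t, x). g t x) \<in> borel_measurable (lborel \<Otimes>\<^sub>M lborel)"
    unfolding g_def by measurable
  have "(\<integral>\<^sup>+ x. g t x \<partial>lborel) = indicator {0..1} t * emeasure lborel S" for t
  proof -
    have "(\<integral>\<^sup>+ x. indicator S (x + t *\<^sub>R e) \<partial>lborel) = (\<integral>\<^sup>+ x. indicator S x \<partial>(distr lborel borel ((+) (t *\<^sub>R e))))"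
      by (subst nn_integral_distr) (auto simp: add.commute)
    also have "\<dots> = emeasure lborel S"
      by (simp add: lborel_distr_plus)
    finally show ?thesis
      by (simp add: g_def nn_integral_cmult)
  qed
  then have "(\<integral>\<^sup>+ t. \<integral>\<^sup>+ x. g t x \<partial>lborel \<partial>lborel) = (\<integral>\<^sup>+ t. indicator {0..1::real} t * emeasure lborel S \<partial>lborel)"
    by simp
  also have "\<dots> = emeasure lborel S"
    by (simp add: nn_integral_multc)
  finally have "emeasure lborel S = (\<integral>\<^sup>+ t. \<integral>\<^sup>+ x. g t x \<partial>lborel \<partial>lborel)" ..
  also have "\<dots> = (\<integral>\<^sup>+ x. \<integral>\<^sup>+ t. g t x \<partial>lborel \<partial>lborel)"
    by (rule lborel_pair.Fubini'[symmetric]) measurable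
  also have "\<dots> = (\<integral>\<^sup>+ x. 0 \<partial>(lborel :: 'a measure))"
  proof (rule nn_integral_cong)
    fix x :: 'a
    have "{t. x + t *\<^sub>R e \<in> S} \<in> sets borel" by measurable
    then have "emeasure lborel {t. x + t *\<^sub>R e \<in> S} = 0"
      using line[of x] by (auto simp: negligible_iff_null_sets null_sets_def)
    moreover have "(\<integral>\<^sup>+ t. g t x \<partial>lborel) \<le> (\<integral>\<^sup>+ t. indicator {t. x + t *\<^sub>R e \<in> S} t \<partial>lborel)"
      by (intro nn_integral_mono) (auto simp: g_def indicator_def)
    moreover have "\<dots> = emeasure lborel {t. x + t *\<^sub>R e \<in> S}"
      by (intro nn_integral_indicator) measurable
    ultimately show "(\<integral>\<^sup>+ t. g t x \<partial>lborel) = 0" by simp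
  qed
  finally show ?thesis by (simp add: negligible_iff_null_sets null_sets_def)
qed

text \<open>Cover the porous points, up to a null set, by disjoint balls in an open set that exceeds
  \<open>E\<close> only slightly: a fixed fraction of each ball lies in the small excess.\<close>

lemma negligible_porous:
  fixes E :: "'a::euclidean_space set"
  assumes E: "E \<in> sets lebesgue" and c: "c > 0"
  shows "negligible {x \<in> E. \<forall>d>0. \<exists>r y. 0 < r \<and> r < d \<and> ball y (c * r) \<subseteq> ball x r - E}" (is "negligible ?P")
  unfolding negligible_outer_le
proof (intro allI impI)
  fix e :: real assume "e > 0"
  \<comment> \<open>A hole has \<open>c ^ DIM('a)\<close> times the volume of the ball around it, so
    holes of total volume \<open>e'\<close> belong to disjoint balls of total volume
    \<open>e\<close>.\<close>
  define e' where "e' = e * c ^ DIM('a)"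
  have "e' > 0" using \<open>e > 0\<close> c by (simp add: e'_def)
  obtain U where U: "open U" "E \<subseteq> U" "(U - E) \<in> lmeasurable" "emeasure lebesgue (U - E) < ennreal e'"
    using sets_lebesgue_outer_open[OF E \<open>e' > 0\<close>] by metis
  define K where "K = {(x, r, y). 0 < r \<and> cball x r \<subseteq> U \<and> ball y (c * r) \<subseteq> ball x r - E}"
  define a where "a = (\<lambda>i :: 'a \<times> real \<times> 'a. fst i)"
  define \<rho> where "\<rho> = (\<lambda>i :: 'a \<times> real \<times> 'a. fst (snd i))"
  define b where "b = (\<lambda>i :: 'a \<times> real \<times> 'a. ball (snd (snd i)) (c * fst (snd i)))"
  have K: "\<rho> i > 0" "cball (a i) (\<rho> i) \<subseteq> U" "b i \<subseteq> cball (a i) (\<rho> i)" "b i \<subseteq> U - E" if "i \<in> K" for i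
  proof -
    obtain x r y where i: "i = (x, r, y)" by (cases i)
    have "0 < r" "cball x r \<subseteq> U" "ball y (c * r) \<subseteq> ball x r - E"
      using that by (auto simp: K_def i)
    moreover from this have "ball y (c * r) \<subseteq> cball x r"
      using ball_subset_cball by blast
    ultimately show "\<rho> i > 0" "cball (a i) (\<rho> i) \<subseteq> U" "b i \<subseteq> cball (a i) (\<rho> i)" "b i \<subseteq> U - E"
      by (auto simp: i a_def \<rho>_def b_def)
  qed
  obtain C where C: "countable C" "C \<subseteq> K"
     "pairwise (\<lambda>i j. disjnt (cball (a i) (\<rho> i)) (cball (a j) (\<rho> j))) C"
     "negligible (?P - (\<Union>i \<in> C. cball (a i) (\<rho> i)))"
  proof (rule Vitali_covering_theorem_cballs[of K \<rho> ?P a])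
    fix x' and d :: real assume x': "x' \<in> ?P" "0 < d"
    then have "x' \<in> U" using \<open>E \<subseteq> U\<close> by blast
    then obtain s where s: "s > 0" "cball x' s \<subseteq> U"
      using \<open>open U\<close> by (metis open_contains_cball)
    have "min d s > 0" using s x' by simp
    with x'(1) have "\<exists>r y. 0 < r \<and> r < min d s \<and> ball y (c * r) \<subseteq> ball x' r - E" by blast
    then obtain r y where ry: "0 < r" "r < min d s" "ball y (c * r) \<subseteq> ball x' r - E" by blast
    have "cball x' r \<subseteq> cball x' s" using ry by (intro subset_cball) simp
    then have "(x', r, y) \<in> K"
      unfolding K_def using s ry by blast
    then show "\<exists>i. i \<in> K \<and> x' \<in> cball (a i) (\<rho> i) \<and> \<rho> i < d"
      using ry by (intro exI[of _ "(x', r, y)"]) (auto simp: a_def \<rho>_def)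
  qed (use K in auto)
  let ?W = "\<Union>i \<in> C. cball (a i) (\<rho> i)"
  have ball: "emeasure lborel (cball (a i) (\<rho> i)) = ennreal (inverse (c ^ DIM('a))) * emeasure lborel (b i)" if "i \<in> C" for i
    using that C(2) K(1)[of i] c
    by (cases i) (auto simp: a_def \<rho>_def b_def emeasure_cball emeasure_ball power_mult_distrib divide_simps simp flip: ennreal_mult)
  have disj: "disjoint_family_on (\<lambda>i. cball (a i) (\<rho> i)) C"
    using C(3) by (simp add: pairwise_def disjoint_family_on_def disjnt_def)
  then have disj': "disjoint_family_on b C"
    using K(3) C(2) unfolding disjoint_family_on_def by blast
  have b: "b i \<in> sets borel" for i
    by (simp add: b_def)
  have "emeasure lborel ?W = (\<integral>\<^sup>+i. emeasure lborel (cball (a i) (\<rho> i)) \<partial>count_space C)"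
    using C disj by (intro emeasure_UN_countable) auto
  also have "\<dots> = (\<integral>\<^sup>+i. ennreal (inverse (c ^ DIM('a))) * emeasure lborel (b i) \<partial>count_space C)"
    by (intro nn_integral_cong) (auto simp: ball)
  also have "\<dots> = ennreal (inverse (c ^ DIM('a))) * (\<integral>\<^sup>+i. emeasure lborel (b i) \<partial>count_space C)"
    by (simp add: nn_integral_cmult)
  also have "(\<integral>\<^sup>+i. emeasure lborel (b i) \<partial>count_space C) = emeasure lborel (\<Union>i\<in>C. b i)"
    by (rule emeasure_UN_countable[symmetric]) (use C(1) disj' b in auto)
  also have "\<dots> = emeasure lebesgue (\<Union>i\<in>C. b i)"
  proof -
    have "(\<Union>i\<in>C. b i) \<in> sets borel" using C(1) b by (intro sets.countable_UN') auto
    then show ?thesis by simp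
  qed
  also have "\<dots> \<le> emeasure lebesgue (U - E)"
    using K(4) C(2) U by (intro emeasure_mono) (auto dest: fmeasurableD)
  also have "\<dots> \<le> ennreal e'" using U by simp
  finally have "emeasure lborel ?W \<le> ennreal (inverse (c ^ DIM('a))) * ennreal e'"
    by (simp add: mult_left_mono)
  also have "\<dots> = ennreal e"
    using c \<open>e > 0\<close> by (simp add: e'_def flip: ennreal_mult)
  finally have "emeasure lborel ?W \<le> ennreal e" .
  moreover have W: "?W \<in> sets borel" using C(1) by (intro sets.countable_UN') auto
  ultimately have We: "emeasure lebesgue ?W \<le> ennreal e" by simp
  have Wl: "?W \<in> lmeasurable"
    using We W by (intro fmeasurableI) (auto intro: le_less_trans)
  have "measure lebesgue ?W \<le> e"
    using We \<open>e > 0\<close> Wl by (simp add: emeasure_eq_measure2 fmeasurableD2 flip: ennreal_le_iff) 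
  moreover define N where "N = ?P - ?W"
  have "negligible N" unfolding N_def by (rule C(4))
  then have "?W \<union> N \<in> lmeasurable" "measure lebesgue (?W \<union> N) = measure lebesgue ?W"
    using Wl by (auto simp: negligible_imp_measurable fmeasurable.Un measure_Un_null_set negligible_iff_null_sets)
  moreover have "?P \<subseteq> ?W \<union> N" unfolding N_def by (simp only: Un_Diff_cancel Un_upper2)
  ultimately show "\<exists>T. ?P \<subseteq> T \<and> T \<in> lmeasurable \<and> measure lebesgue T \<le> e"
    by (intro exI[of _ "?W \<union> N"]) simp
qed

section \<open>Directional derivatives\<close>

text \<open>The candidate derivative is the upper limit of the slopes, that is, the supremum of the
  values exceeded by slopes arbitrarily close to 0. If slopes also fell below it by a fixed amount
  arbitrarily close to 0, two rationals \<open>u < v\<close> in between would violate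
  \<open>gap\<close>.\<close>

lemma has_derivative_if_slopes_squeezed:
  fixes g :: "real \<Rightarrow> real"
  assumes lip: "\<And>t. \<bar>g t - g 0\<bar> \<le> K * \<bar>t\<bar>"
    and gap: "\<And>u v. u \<in> \<rat> \<Longrightarrow> v \<in> \<rat> \<Longrightarrow> u < v \<Longrightarrow>
      (\<exists>d>0. \<forall>t. t \<noteq> 0 \<longrightarrow> \<bar>t\<bar> < d \<longrightarrow> u \<le> (g t - g 0) / t) \<or>
      (\<exists>d>0. \<forall>t. t \<noteq> 0 \<longrightarrow> \<bar>t\<bar> < d \<longrightarrow> (g t - g 0) / t \<le> v)"
  shows "\<exists>c. (g has_real_derivative c) (at 0)"
proof -
  define s where "s t = (g t - g 0) / t" for t
  have s: "-K \<le> s t" "s t \<le> K" if "t \<noteq> 0" for t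
  proof -
    have "\<bar>s t\<bar> \<le> K"
      using lip[of t] that by (simp add: s_def abs_divide pos_divide_le_eq)
    then show "-K \<le> s t" "s t \<le> K" by (auto simp: abs_le_iff)
  qed
  define S where "S = {v. \<forall>d>0. \<exists>t. t \<noteq> 0 \<and> \<bar>t\<bar> < d \<and> v < s t}"
  have nz: "\<exists>t. t \<noteq> 0 \<and> \<bar>t\<bar> < d" if "d > 0" for d :: real
    using that by (intro exI[of _ "d/2"]) auto
  have "-K - 1 \<in> S"
    unfolding S_def
  proof (clarify)
    fix d :: real assume "d > 0"
    then obtain t where "t \<noteq> 0" "\<bar>t\<bar> < d" using nz by blast
    then show "\<exists>t. t \<noteq> 0 \<and> \<bar>t\<bar> < d \<and> -K - 1 < s t"
      using s(1)[of t] by (intro exI[of _ t]) auto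
  qed
  then have "S \<noteq> {}" by blast
  have bound: "v \<le> K" if v: "v \<in> S" for v
  proof -
    obtain t where "t \<noteq> 0" "v < s t"
      using v[unfolded S_def, THEN CollectD, rule_format, OF zero_less_one] by blast
    then show ?thesis using s(2)[of t] by simp
  qed
  then have bdd: "bdd_above S" by (auto simp: bdd_above_def)
  define c where "c = Sup S"
  have "\<exists>d>0. \<forall>t. t \<noteq> 0 \<and> \<bar>t\<bar> < d \<longrightarrow> \<bar>s t - c\<bar> < e" if "e > 0" for e
  proof -
    have "c + e / 2 \<notin> S"
      using cSup_upper[OF _ bdd, of "c + e / 2"] \<open>e > 0\<close> by (auto simp: c_def)
    then obtain d1 where d1: "d1 > 0" "\<And>t. t \<noteq> 0 \<Longrightarrow> \<bar>t\<bar> < d1 \<Longrightarrow> \<not> c + e / 2 < s t"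
      unfolding S_def by blast
    obtain v' where v': "v' \<in> S" "c - e / 4 < v'"
      using less_cSupE[OF _ \<open>S \<noteq> {}\<close>, of "c - e / 4"] \<open>e > 0\<close> by (auto simp: c_def)
    obtain v where v: "v \<in> \<rat>" "c - e / 4 < v" "v < v'"
      using Rats_dense_in_real[OF v'(2)] by blast
    obtain u where u: "u \<in> \<rat>" "c - e < u" "u < c - e / 4"
      using Rats_dense_in_real[of "c - e" "c - e / 4"] \<open>e > 0\<close> by auto
    have "\<not> (\<exists>d>0. \<forall>t. t \<noteq> 0 \<longrightarrow> \<bar>t\<bar> < d \<longrightarrow> s t \<le> v)"
    proof
      assume "\<exists>d>0. \<forall>t. t \<noteq> 0 \<longrightarrow> \<bar>t\<bar> < d \<longrightarrow> s t \<le> v"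
      then obtain d where "d > 0" "\<forall>t. t \<noteq> 0 \<longrightarrow> \<bar>t\<bar> < d \<longrightarrow> s t \<le> v" by blast
      moreover obtain t where "t \<noteq> 0" "\<bar>t\<bar> < d" "v' < s t"
        using v'(1)[unfolded S_def, THEN CollectD, rule_format, OF \<open>d > 0\<close>] by blast
      ultimately show False using v(3) by force
    qed
    then obtain d2 where d2: "d2 > 0" "\<And>t. t \<noteq> 0 \<Longrightarrow> \<bar>t\<bar> < d2 \<Longrightarrow> u \<le> s t"
      using gap[OF u(1) v(1)] less_trans[OF u(3) v(2)] unfolding s_def by blast
    show ?thesis
    proof (intro exI[of _ "min d1 d2"] conjI allI impI)
      fix t assume "t \<noteq> 0 \<and> \<bar>t\<bar> < min d1 d2"
      then show "\<bar>s t - c\<bar> < e"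
        using d1(2)[of t] d2(2)[of t] u \<open>e > 0\<close> by (auto simp: abs_less_iff)
    qed (use d1 d2 in auto)
  qed
  then have "(\<lambda>h. (g (0 + h) - g 0) / h) \<midarrow>0\<rightarrow> c"
    unfolding LIM_eq by (simp add: s_def)
  then show ?thesis by (auto simp: DERIV_def)
qed

text \<open>Where the derivative fails to exist, some pair of rationals separates slopes that recur
  at arbitrarily small scales. On each line in direction \<open>e\<close>, adding
  \<open>K * t\<close> makes \<open>f\<close> monotone and shifts all slopes by \<open>K\<close>, so
  each of these countably many sets meets the line in a null set.\<close>

lemma negligible_no_directional_derivative:
  fixes f :: "'a::euclidean_space \<Rightarrow> real"
  assumes f: "L-lipschitz_on UNIV f"
  shows "negligible {x. \<nexists>c. ((\<lambda>t. f (x + t *\<^sub>R e)) has_real_derivative c) (at 0)}"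
proof -
  define s where "s x t = (f (x + t *\<^sub>R e) - f x) / t" for x t
  define B where "B = (\<lambda>(u, v). {x. \<forall>d>0. \<exists>t. t \<noteq> 0 \<and> \<bar>t\<bar> < d \<and> s x t < u} \<inter>
                                  {x. \<forall>d>0. \<exists>t. t \<noteq> 0 \<and> \<bar>t\<bar> < d \<and> v < s x t})"
  define K where "K = L * norm e"
  have lip: "\<bar>f (x + t *\<^sub>R e) - f (x + t' *\<^sub>R e)\<bar> \<le> K * \<bar>t - t'\<bar>" for x t t'
  proof -
    have "dist (f (x + t *\<^sub>R e)) (f (x + t' *\<^sub>R e)) \<le> L * dist (x + t *\<^sub>R e) (x + t' *\<^sub>R e)"
      by (rule lipschitz_onD[OF f]) auto
    also have "dist (x + t *\<^sub>R e) (x + t' *\<^sub>R e) = norm ((t - t') *\<^sub>R e)"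
      by (simp add: dist_norm algebra_simps)
    finally show ?thesis by (simp add: K_def dist_real_def mult_ac)
  qed
  have cont: "continuous_on UNIV f"
    using f by (rule lipschitz_on_continuous_on)
  have "negligible (B (u, v))" if "u < v" for u v
  proof (rule negligible_if_negligible_on_lines)
    have "v < s x t \<longleftrightarrow> (- f (x + t *\<^sub>R e) - - f x) / t < - v" for x t
      by (simp add: s_def diff_divide_distrib) linarith
    then show "B (u, v) \<in> sets borel"
      unfolding B_def s_def prod.case
      by (simp only:) (intro sets.Int slope_set_Borel cont continuous_on_minus)
    fix x
    define g where "g t = f (x + t *\<^sub>R e) + K * t" for t
    have "mono g"
    proof (rule monoI)
      fix a b :: real assume "a \<le> b"
      then show "g a \<le> g b" using lip[of x a b] by (simp add: g_def abs_le_iff algebra_simps)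
    qed
    have "continuous_on UNIV g"
      unfolding g_def by (intro continuous_intros continuous_on_compose2[OF cont]) auto
    have g: "(g (a + t) - g a) / t = s (x + a *\<^sub>R e) t + K" if "t \<noteq> 0" for a t
      using that by (simp add: g_def s_def field_simps)
    have "{a. x + a *\<^sub>R e \<in> B (u, v)} \<subseteq>
      {a. (\<forall>d>0. \<exists>t. t \<noteq> 0 \<and> \<bar>t\<bar> < d \<and> (g (a + t) - g a) / t < u + K) \<and>
          (\<forall>d>0. \<exists>t. t \<noteq> 0 \<and> \<bar>t\<bar> < d \<and> (g (a + t) - g a) / t > v + K)}"
    proof (intro subsetI CollectI conjI allI impI; clarify)
      fix a d :: real assume d: "d > 0" and a: "x + a *\<^sub>R e \<in> B (u, v)"
      from a d obtain t where "t \<noteq> 0" "\<bar>t\<bar> < d" "s (x + a *\<^sub>R e) t < u"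
        unfolding B_def by blast
      then show "\<exists>t. t \<noteq> 0 \<and> \<bar>t\<bar> < d \<and> (g (a + t) - g a) / t < u + K"
        using g[of t a] by auto
      from a d obtain t where "t \<noteq> 0" "\<bar>t\<bar> < d" "v < s (x + a *\<^sub>R e) t"
        unfolding B_def by blast
      then show "\<exists>t. t \<noteq> 0 \<and> \<bar>t\<bar> < d \<and> v + K < (g (a + t) - g a) / t"
        using g[of t a] by auto
    qed
    moreover have "negligible \<dots>"
      using \<open>mono g\<close> \<open>continuous_on UNIV g\<close> that by (intro negligible_slope_gap_mono) auto
    ultimately show "negligible {a. x + a *\<^sub>R e \<in> B (u, v)}"
      by (rule negligible_subset[rotated])
  qed
  then have "negligible (\<Union>(B ` {(u, v). u \<in> \<rat> \<and> v \<in> \<rat> \<and> u < v}))"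
  proof (intro negligible_countable_Union countable_image)
    have "{(u, v). u \<in> \<rat> \<and> v \<in> \<rat> \<and> u < (v::real)} \<subseteq> \<rat> \<times> \<rat>" by auto
    then show "countable {(u, v). u \<in> \<rat> \<and> v \<in> \<rat> \<and> u < (v::real)}"
      by (rule countable_subset) (intro countable_SIGMA countable_rat)
  qed auto
  moreover have "{x. \<nexists>c. ((\<lambda>t. f (x + t *\<^sub>R e)) has_real_derivative c) (at 0)}
    \<subseteq> \<Union>(B ` {(u, v). u \<in> \<rat> \<and> v \<in> \<rat> \<and> u < v})"
  proof (rule subsetI, rule ccontr)
    fix x assume x: "x \<in> {x. \<nexists>c. ((\<lambda>t. f (x + t *\<^sub>R e)) has_real_derivative c) (at 0)}"
      and nB: "x \<notin> \<Union>(B ` {(u, v). u \<in> \<rat> \<and> v \<in> \<rat> \<and> u < v})"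
    have "\<exists>c. ((\<lambda>t. f (x + t *\<^sub>R e)) has_real_derivative c) (at 0)"
    proof (rule has_derivative_if_slopes_squeezed)
      show "\<bar>f (x + t *\<^sub>R e) - f (x + 0 *\<^sub>R e)\<bar> \<le> K * \<bar>t\<bar>" for t
        using lip[of x t 0] by simp
    next
      fix u v :: real assume "u \<in> \<rat>" "v \<in> \<rat>" "u < v"
      then have "x \<notin> B (u, v)" using nB by blast
      then consider d where "d > 0" "\<And>t. t \<noteq> 0 \<Longrightarrow> \<bar>t\<bar> < d \<Longrightarrow> \<not> s x t < u"
        | d where "d > 0" "\<And>t. t \<noteq> 0 \<Longrightarrow> \<bar>t\<bar> < d \<Longrightarrow> \<not> v < s x t"
        unfolding B_def by blast
      then show "(\<exists>d>0. \<forall>t. t \<noteq> 0 \<longrightarrow> \<bar>t\<bar> < d \<longrightarrow> u \<le> (f (x + t *\<^sub>R e) - f (x + 0 *\<^sub>R e)) / t) \<or>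
            (\<exists>d>0. \<forall>t. t \<noteq> 0 \<longrightarrow> \<bar>t\<bar> < d \<longrightarrow> (f (x + t *\<^sub>R e) - f (x + 0 *\<^sub>R e)) / t \<le> v)"
      proof cases
        case (1 d)
        then show ?thesis by (intro disjI1 exI[of _ d]) (auto simp: s_def not_less)
      next
        case (2 d)
        then show ?thesis by (intro disjI2 exI[of _ d]) (auto simp: s_def not_less)
      qed
    qed
    with x show False by blast
  qed
  ultimately show ?thesis by (rule negligible_subset)
qed

section \<open>From partial to total differentiability\<close>

text \<open>The tolerance holds uniformly for all steps up to a fixed \<open>\<delta>\<close>, and
  \<open>c\<close> is a candidate gradient fixed in advance. This makes the set closed for
  continuous \<open>f\<close>, and countably many such sets contain every point at which all partial
  derivatives exist.\<close>

definition slope_set :: "('a::euclidean_space \<Rightarrow> real) \<Rightarrow> real \<Rightarrow> real \<Rightarrow> 'a \<Rightarrow> 'a set" where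
  "slope_set f \<delta> \<epsilon> c =
     {x. \<forall>b\<in>Basis. \<forall>t. \<bar>t\<bar> \<le> \<delta> \<longrightarrow> \<bar>f (x + t *\<^sub>R b) - f x - t * (c \<bullet> b)\<bar> \<le> \<epsilon> * \<bar>t\<bar>}"

lemma closed_slope_set:
  assumes "continuous_on UNIV f"
  shows "closed (slope_set f \<delta> \<epsilon> c)"
proof -
  have "slope_set f \<delta> \<epsilon> c = (\<Inter>b\<in>Basis. \<Inter>t\<in>{-\<delta>..\<delta>}.
      {x. \<bar>f (x + t *\<^sub>R b) - f x - t * (c \<bullet> b)\<bar> \<le> \<epsilon> * \<bar>t\<bar>})"
    by (auto simp: slope_set_def abs_le_iff) 
  moreover have "closed {x. \<bar>f (x + t *\<^sub>R b) - f x - t * (c \<bullet> b)\<bar> \<le> \<epsilon> * \<bar>t\<bar>}" for b t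
    by (intro closed_Collect_le continuous_intros assms continuous_on_compose2[OF assms]) auto
  ultimately show ?thesis by (auto intro!: closed_INT)
qed

text \<open>Walk from \<open>x\<close> to \<open>x + h\<close> one coordinate at a time; each corner of the path may be moved to a
  nearby point of the slope set at a cost controlled by the Lipschitz constant.\<close>

lemma slope_set_linear_approx:
  fixes f :: "'a::euclidean_space \<Rightarrow> real"
  assumes f: "L-lipschitz_on UNIV f" and "\<eta> > 0" "norm h > 0"
    and h: "norm h \<le> \<delta>"
    and near: "\<And>z. dist x z \<le> DIM('a) * norm h \<Longrightarrow> \<exists>y\<in>slope_set f \<delta> \<epsilon> c. dist y z < \<eta> * norm h"
  shows "\<bar>f (x + h) - f x - c \<bullet> h\<bar> \<le> DIM('a) * ((\<epsilon> + 2 * L * \<eta>) * norm h)"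
proof -
  have L: "L \<ge> 0" using f by (rule lipschitz_on_nonneg)
  have lip: "\<bar>f u - f v\<bar> \<le> L * norm (u - v)" for u v
    using lipschitz_onD[OF f, of u v] by (simp add: dist_norm)
  define z where "z B = x + (\<Sum>b\<in>B. (h \<bullet> b) *\<^sub>R b)" for B
  have hb: "\<bar>h \<bullet> b\<bar> \<le> norm h" if "b \<in> Basis" for b
    using Basis_le_norm[OF that] by simp
  have "\<bar>f (z B) - f x - (\<Sum>b\<in>B. (h \<bullet> b) * (c \<bullet> b))\<bar> \<le> card B * ((\<epsilon> + 2 * L * \<eta>) * norm h)"
    if "B \<subseteq> Basis" for B
    using finite_subset[OF that finite_Basis] that
  proof (induction B rule: finite_induct)
    case empty
    then show ?case by (simp add: z_def)
  next
    case (insert b B)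
    then have b: "b \<in> Basis" and B: "B \<subseteq> Basis" by auto
    have "dist x (z B) = norm (\<Sum>b\<in>B. (h \<bullet> b) *\<^sub>R b)"
      by (simp add: z_def dist_norm)
    also have "\<dots> \<le> (\<Sum>b\<in>B. norm h)"
      using B hb by (intro sum_norm_le) auto
    also have "\<dots> \<le> DIM('a) * norm h"
      using B by (auto intro!: mult_right_mono card_mono)
    finally obtain y where y: "y \<in> slope_set f \<delta> \<epsilon> c" "dist y (z B) < \<eta> * norm h"
      using near by blast
    have "\<bar>f (y + (h \<bullet> b) *\<^sub>R b) - f y - (h \<bullet> b) * (c \<bullet> b)\<bar> \<le> \<epsilon> * \<bar>h \<bullet> b\<bar>"
      using y(1) b hb[OF b] h unfolding slope_set_def by auto
    moreover have "\<bar>f (z B) - f y\<bar> \<le> L * (\<eta> * norm h)"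
      using lip[of "z B" y] y(2) L by (smt (verit) dist_commute dist_norm mult_left_mono)
    moreover have "\<bar>f (z B + (h \<bullet> b) *\<^sub>R b) - f (y + (h \<bullet> b) *\<^sub>R b)\<bar> \<le> L * (\<eta> * norm h)"
      using lip[of "z B + (h \<bullet> b) *\<^sub>R b" "y + (h \<bullet> b) *\<^sub>R b"] y(2) L
      by (smt (verit) add_diff_cancel_right dist_commute dist_norm mult_left_mono)
    moreover have "\<epsilon> * \<bar>h \<bullet> b\<bar> \<le> \<epsilon> * norm h"
    proof (rule mult_left_mono[OF hb[OF b]])
      have "0 \<le> \<epsilon> * \<bar>norm h\<bar>"
      proof -
        have "\<bar>f (y + norm h *\<^sub>R b) - f y - norm h * (c \<bullet> b)\<bar> \<le> \<epsilon> * \<bar>norm h\<bar>"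
          using y(1) h unfolding slope_set_def by (auto dest!: bspec[OF _ b] spec[of _ "norm h"])
        then show ?thesis by linarith
      qed
      then show "\<epsilon> \<ge> 0" using \<open>norm h > 0\<close> by (simp add: zero_le_mult_iff)
    qed
    moreover have "z (insert b B) = z B + (h \<bullet> b) *\<^sub>R b"
      using insert.hyps by (simp add: z_def)
    ultimately have "\<bar>f (z (insert b B)) - f (z B) - (h \<bullet> b) * (c \<bullet> b)\<bar> \<le> (\<epsilon> + 2 * L * \<eta>) * norm h"
      by (simp add: abs_le_iff algebra_simps)
    with insert.IH[OF B] insert.hyps show ?case
      by (simp add: abs_le_iff algebra_simps)
  qed
  from this[of Basis] show ?thesis
    by (simp add: z_def euclidean_representation) (simp add: euclidean_inner[of c h] mult.commute)
qed

text \<open>Almost every point of a slope set is not a point of porosity of that set, and there partial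
  derivatives that exist already give total differentiability. So no integration by parts is needed.\<close>

theorem Rademacher_real:
  fixes f :: "'a::euclidean_space \<Rightarrow> real"
  assumes f: "L-lipschitz_on UNIV f"
  shows "negligible {x. \<not> f differentiable at x}"
proof -
  have L: "L \<ge> 0" using f by (rule lipschitz_on_nonneg)
  have cont: "continuous_on UNIV f"
    using f by (rule lipschitz_on_continuous_on)
  \<comment> \<open>Candidate gradients are taken from a countable dense set to keep the family of
    slope sets countable.\<close>
  obtain D :: "'a set" where D: "countable D" "\<And>X. open X \<Longrightarrow> X \<noteq> {} \<Longrightarrow> \<exists>d\<in>D. d \<in> X"
    using countable_dense_exists by blast
  define n where "n = real DIM('a)"
  have n: "n \<ge> 1" by (simp add: n_def Suc_leI)
  define E where "E = (\<lambda>(m, N, c). slope_set f (1 / Suc m) (2 / Suc N) c)"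
  define P where "P = (\<lambda>(i, k). {x \<in> E i. \<forall>d>0. \<exists>r y. 0 < r \<and> r < d \<and> ball y (1 / Suc k * r) \<subseteq> ball x r - E i})"
  define Q where "Q = (\<lambda>b. {x. \<nexists>c. ((\<lambda>t. f (x + t *\<^sub>R b)) has_real_derivative c) (at 0)})"
  define I where "I = (UNIV :: nat set) \<times> (UNIV :: nat set) \<times> D"
  have "negligible (\<Union>(Q ` Basis) \<union> \<Union>(P ` (I \<times> UNIV)))"
  proof (intro negligible_Un negligible_countable_Union countable_image)
    show "countable (I \<times> (UNIV::nat set))" unfolding I_def using D(1) by auto
    fix S assume "S \<in> P ` (I \<times> UNIV)"
    then obtain i k where S: "S = P (i, k)" by auto
    have "closed (E i)" unfolding E_def by (auto simp: case_prod_beta intro!: closed_slope_set cont)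
    then have "E i \<in> sets lebesgue" by (simp add: borel_closed)
    then show "negligible S"
      unfolding S P_def prod.case by (rule negligible_porous) simp
  next
    fix S assume "S \<in> Q ` Basis"
    then show "negligible S" unfolding Q_def using negligible_no_directional_derivative[OF f] by auto
  qed (auto simp: countable_finite)
  moreover have "f differentiable at x" if Q: "\<And>b. b \<in> Basis \<Longrightarrow> x \<notin> Q b" and P: "\<And>i k. i \<in> I \<Longrightarrow> x \<notin> P (i, k)" for x
  proof -
    have "\<forall>b\<in>Basis. \<exists>c. ((\<lambda>t. f (x + t *\<^sub>R b)) has_real_derivative c) (at 0)"
      using Q by (auto simp: Q_def)
    then obtain p where p: "\<And>b. b \<in> Basis \<Longrightarrow> ((\<lambda>t. f (x + t *\<^sub>R b)) has_real_derivative p b) (at 0)"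
      by metis
    define g where "g = (\<Sum>b\<in>Basis. p b *\<^sub>R b)"
    have gb: "g \<bullet> b = p b" if "b \<in> Basis" for b
      using that by (simp add: g_def)
    have "(f has_derivative (\<lambda>h. g \<bullet> h)) (at x)"
      unfolding has_derivative_at_alt
    proof (intro conjI allI impI)
      show "bounded_linear (\<lambda>h. g \<bullet> h)" by (rule bounded_linear_inner_right)
      fix e :: real assume "e > 0"
      \<comment> \<open>The error consists of three parts, each at most \<open>e / 5\<close> times
        the norm of the increment: the tolerance of the slope set, the displacement of corners by
        \<open>\<eta>\<close>, and the replacement of \<open>g\<close> by \<open>c\<close>.\<close>
      define \<epsilon> where "\<epsilon> = e / (5 * n)"
      have "\<epsilon> > 0" using \<open>e > 0\<close> n by (simp add: \<epsilon>_def)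
      obtain N where N: "2 / Suc N < \<epsilon>"
        using reals_Archimedean[of "\<epsilon>/2"] \<open>\<epsilon> > 0\<close> by (auto simp: field_simps)
      obtain c where c: "c \<in> D" "dist g c < 1 / Suc N"
        using D(2)[of "ball g (1 / Suc N)"] by auto
      have gc: "\<bar>(g - c) \<bullet> h\<bar> \<le> norm h / Suc N" for h
      proof -
        have "\<bar>(g - c) \<bullet> h\<bar> \<le> norm (g - c) * norm h" by (rule Cauchy_Schwarz_ineq2)
        also have "\<dots> \<le> 1 / Suc N * norm h"
          using c(2) by (intro mult_right_mono) (auto simp: dist_norm)
        finally show ?thesis by simp
      qed
      \<comment> \<open>Half of the tolerance \<open>2 / Suc N\<close> pays for the difference
        quotient, the other half for replacing \<open>g\<close> by \<open>c\<close>.\<close>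
      have "\<exists>d>0. \<forall>t. \<bar>t\<bar> \<le> d \<longrightarrow> \<bar>f (x + t *\<^sub>R b) - f x - t * (c \<bullet> b)\<bar> \<le> 2 / Suc N * \<bar>t\<bar>" if b: "b \<in> Basis" for b
      proof -
        have "1 / Suc N > 0" by simp
        then obtain d where d: "d > 0" "\<And>t. norm (t - 0) < d \<Longrightarrow> norm (f (x + t *\<^sub>R b) - f (x + 0 *\<^sub>R b) - p b * (t - 0)) \<le> 1 / Suc N * norm (t - 0)"
          using p[OF b] unfolding has_field_derivative_def has_derivative_at_alt by blast
        have "\<bar>f (x + t *\<^sub>R b) - f x - t * (c \<bullet> b)\<bar> \<le> 2 / Suc N * \<bar>t\<bar>" if "\<bar>t\<bar> \<le> d / 2" for t
        proof -
          have "\<bar>f (x + t *\<^sub>R b) - f x - p b * t\<bar> \<le> 1 / Suc N * \<bar>t\<bar>"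
            using d(2)[of t] that \<open>d > 0\<close> by simp
          moreover have "p b * t - t * (c \<bullet> b) = (g - c) \<bullet> (t *\<^sub>R b)"
            using gb[OF b] by (simp add: inner_diff_left algebra_simps)
          moreover have "\<bar>(g - c) \<bullet> (t *\<^sub>R b)\<bar> \<le> 1 / Suc N * \<bar>t\<bar>"
            using gc[of "t *\<^sub>R b"] b by simp
          moreover have "2 / Suc N * \<bar>t\<bar> = 1 / Suc N * \<bar>t\<bar> + 1 / Suc N * \<bar>t\<bar>" by (simp flip: add_divide_distrib)
          ultimately show ?thesis by linarith
        qed
        then show ?thesis using d(1) by (intro exI[of _ "d/2"]) auto
      qed
      then obtain d where d: "\<And>b. b \<in> Basis \<Longrightarrow> d b > 0"
        "\<And>b t. b \<in> Basis \<Longrightarrow> \<bar>t\<bar> \<le> d b \<Longrightarrow> \<bar>f (x + t *\<^sub>R b) - f x - t * (c \<bullet> b)\<bar> \<le> 2 / Suc N * \<bar>t\<bar>"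
        by metis
      define d' where "d' = Min (d ` Basis)"
      have "d' > 0" using d by (simp add: d'_def)
      obtain m where m: "1 / Suc m < d'"
        using reals_Archimedean[OF \<open>d' > 0\<close>] by (auto simp: inverse_eq_divide)
      have d': "d' \<le> d b" if "b \<in> Basis" for b using that by (simp add: d'_def)
      define i where "i = (m, N, c)"
      have xE: "x \<in> E i"
        unfolding E_def i_def slope_set_def prod.case using d(2) m d' by fastforce
      have "i \<in> I" using c by (simp add: i_def I_def)
      define \<eta> where "\<eta> = e / (10 * n * (L + 1))"
      have "\<eta> > 0" using \<open>e > 0\<close> n L by (simp add: \<eta>_def)
      \<comment> \<open>If \<open>z\<close> lies within \<open>n * norm h\<close> of
        \<open>x\<close>, then the ball of radius \<open>\<eta> * norm h\<close> around
        \<open>z\<close> lies in the ball of radius \<open>(n + 1 + \<eta>) * norm h\<close> around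
        \<open>x\<close>. The quotient of these radii is the porosity ratio to be excluded, so that
        the small ball must meet the slope set.\<close>
      obtain k where k: "1 / Suc k < \<eta> / (n + 1 + \<eta>)"
        using reals_Archimedean[of "\<eta> / (n + 1 + \<eta>)"] \<open>\<eta> > 0\<close> n by (auto simp: inverse_eq_divide)
      obtain d0 where d0: "d0 > 0" "\<And>r y. 0 < r \<Longrightarrow> r < d0 \<Longrightarrow> \<not> ball y (1 / Suc k * r) \<subseteq> ball x r - E i"
        using P[OF \<open>i \<in> I\<close>, of k] xE unfolding P_def prod.case by blast
      show "\<exists>d>0. \<forall>y. norm (y - x) < d \<longrightarrow> norm (f y - f x - g \<bullet> (y - x)) \<le> e * norm (y - x)"
      proof (intro exI[of _ "min (1 / Suc m) (d0 / (n + 1 + \<eta>))"] conjI allI impI)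
        show "0 < min (1 / Suc m) (d0 / (n + 1 + \<eta>))" using d0 n \<open>\<eta> > 0\<close> by simp
        fix y assume y: "norm (y - x) < min (1 / Suc m) (d0 / (n + 1 + \<eta>))"
        define h where "h = y - x"
        show "norm (f y - f x - g \<bullet> (y - x)) \<le> e * norm (y - x)"
        proof (cases "h = 0")
          case True
          then show ?thesis by (simp add: h_def)
        next
          case False
          have "\<bar>f (x + h) - f x - c \<bullet> h\<bar> \<le> DIM('a) * ((2 / Suc N + 2 * L * \<eta>) * norm h)"
          proof (rule slope_set_linear_approx[OF f \<open>\<eta> > 0\<close>, of h "1 / Suc m"])
            show "0 < norm h" "norm h \<le> 1 / Suc m" using False y by (auto simp: h_def)
            fix z assume z: "dist x z \<le> DIM('a) * norm h"
            define r where "r = (n + 1 + \<eta>) * norm h"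
            have "r > 0" using False n \<open>\<eta> > 0\<close> by (simp add: r_def)
            have "r < d0" using y n \<open>\<eta> > 0\<close> by (simp add: r_def h_def field_simps)
            with \<open>r > 0\<close> have "\<not> ball z (1 / Suc k * r) \<subseteq> ball x r - E i" by (rule d0(2))
            have small: "1 / Suc k * r \<le> \<eta> * norm h"
            proof -
              have "1 / Suc k * r \<le> \<eta> / (n + 1 + \<eta>) * r"
                using k \<open>r > 0\<close> by (intro mult_right_mono) auto
              also have "\<dots> = \<eta> * norm h" using n \<open>\<eta> > 0\<close> by (simp add: r_def)
              finally show ?thesis .
            qed
            have "ball z (1 / Suc k * r) \<subseteq> ball x r"
            proof
              fix w assume "w \<in> ball z (1 / Suc k * r)"
              then have "dist z w < \<eta> * norm h" using small by simp
              then have "dist x w < n * norm h + \<eta> * norm h"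
                using z dist_triangle[of x w z] by (simp add: n_def)
              also have "\<dots> \<le> r" by (simp add: r_def algebra_simps)
              finally show "w \<in> ball x r" by simp
            qed
            with \<open>\<not> ball z (1 / Suc k * r) \<subseteq> ball x r - E i\<close> obtain w where "w \<in> E i" "dist z w < 1 / Suc k * r"
              by auto
            with small show "\<exists>y\<in>slope_set f (1 / Suc m) (2 / Suc N) c. dist y z < \<eta> * norm h"
              by (intro bexI[of _ w]) (auto simp: E_def i_def dist_commute)
          qed
          also have "\<dots> \<le> n * ((\<epsilon> + 2 * L * \<eta>) * norm h)"
            unfolding n_def using N by (intro mult_left_mono mult_right_mono) auto
          also have "\<dots> = (n * \<epsilon> + 2 * L * (n * \<eta>)) * norm h"
            by (simp add: algebra_simps)
          also have "\<dots> \<le> (e / 5 + e / 5) * norm h"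
          proof (intro mult_right_mono add_mono)
            show "n * \<epsilon> \<le> e / 5" using n by (simp add: \<epsilon>_def)
            have "L * (n * \<eta>) \<le> (L + 1) * (n * \<eta>)"
              using n \<open>\<eta> > 0\<close> by (intro mult_right_mono) auto
            also have "\<dots> = \<eta> * (10 * n * (L + 1)) / 10" by simp
            also have "\<dots> = e / 10"
            proof -
              have "10 * n * (L + 1) \<noteq> 0" using n L by simp
              then show ?thesis unfolding \<eta>_def by (simp only: nonzero_divide_mult_cancel_right times_divide_eq_left nonzero_mult_div_cancel_right not_False_eq_True)
            qed
            finally show "2 * L * (n * \<eta>) \<le> e / 5" by simp
          qed simp
          finally have "\<bar>f (x + h) - f x - c \<bullet> h\<bar> \<le> 2 / 5 * e * norm h" by (simp add: algebra_simps)
          moreover have "\<bar>(g - c) \<bullet> h\<bar> \<le> e / 5 * norm h"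
          proof -
            have "1 / Suc N \<le> e / 5"
            proof -
              have "1 / Suc N \<le> 2 / Suc N" by (simp add: divide_right_mono)
              also have "\<dots> \<le> e / (5 * n)" using N by (simp add: \<epsilon>_def)
              also have "\<dots> \<le> e / 5" using n \<open>e > 0\<close> by (intro divide_left_mono) auto
              finally show ?thesis .
            qed
            then have "norm h / Suc N \<le> e / 5 * norm h"
              using mult_right_mono[of "1 / Suc N" "e / 5" "norm h"] by simp
            with gc[of h] show ?thesis by linarith
          qed
          ultimately have "\<bar>f (x + h) - f x - g \<bullet> h\<bar> \<le> 2 / 5 * e * norm h + e / 5 * norm h"
            unfolding inner_diff_left by linarith
          also have "\<dots> \<le> e * norm h" using \<open>e > 0\<close> by (simp add: algebra_simps)
          finally show ?thesis by (simp add: h_def)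
        qed
      qed
    qed
    then show ?thesis by (auto simp: differentiable_def)
  qed
  then have "{x. \<not> f differentiable at x} \<subseteq> \<Union>(Q ` Basis) \<union> \<Union>(P ` (I \<times> UNIV))"
    by blast
  ultimately show ?thesis by (rule negligible_subset)
qed

section \<open>Volumes of cylinders over discs\<close>

text \<open>The height is 1, so that for a unit vector \<open>\<nu>\<close> the volume is the
  (n-1)-dimensional volume of the base disc.\<close>

definition cylinder :: "'a::euclidean_space \<Rightarrow> real \<Rightarrow> 'a set" where
  "cylinder \<nu> r = {x. 0 \<le> x \<bullet> \<nu> \<and> x \<bullet> \<nu> \<le> 1 \<and> norm (x - (x \<bullet> \<nu>) *\<^sub>R \<nu>) \<le> r}"

lemma compact_cylinder:
  fixes \<nu> :: "'a::euclidean_space"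
  assumes "norm \<nu> = 1"
  shows "compact (cylinder \<nu> r)"
proof (rule compact_eq_bounded_closed[THEN iffD2], rule conjI)
  have "norm x \<le> 1 + r" if "x \<in> cylinder \<nu> r" for x
  proof -
    have "norm x \<le> norm ((x \<bullet> \<nu>) *\<^sub>R \<nu>) + norm (x - (x \<bullet> \<nu>) *\<^sub>R \<nu>)"
      by (metis norm_triangle_sub)
    also have "norm ((x \<bullet> \<nu>) *\<^sub>R \<nu>) \<le> 1"
      using that assms by (simp add: cylinder_def)
    finally show ?thesis using that by (simp add: cylinder_def)
  qed
  then show "bounded (cylinder \<nu> r)" by (auto simp: bounded_iff)
  show "closed (cylinder \<nu> r)"
    unfolding cylinder_def by (intro closed_Collect_conj closed_Collect_le continuous_intros)
qed

text \<open>For a coordinate axis the cylinder is a product: integrating out the coordinate of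
  \<open>b\<close> contributes 1 and leaves a ball in the remaining coordinates.\<close>

lemma emeasure_cylinder_Basis:
  fixes b :: "'a::euclidean_space"
  assumes b: "b \<in> Basis" and r: "r > 0"
  shows "emeasure lborel (cylinder b r) = ennreal (unit_ball_vol (real (DIM('a) - 1)) * r ^ (DIM('a) - 1))"
proof -
  interpret product_sigma_finite "\<lambda>_. lborel :: real measure"
    by standard
  define I where "I = Basis - {b}"
  have I: "finite I" "b \<notin> I" "Basis = insert b I" using b by (auto simp: I_def)
  define v where "v f = (\<Sum>i\<in>Basis. f i *\<^sub>R i)" for f :: "'a \<Rightarrow> real"
  have vb: "v f \<bullet> i = f i" if "i \<in> Basis" for f i
    using that by (simp add: v_def)
  have nrm: "norm (v f - (v f \<bullet> b) *\<^sub>R b) = sqrt (\<Sum>i\<in>I. (f i)\<^sup>2)" for f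
  proof -
    have "v f - (v f \<bullet> b) *\<^sub>R b = (\<Sum>i\<in>I. f i *\<^sub>R i)"
      by (simp add: vb b) (simp add: v_def sum.remove[OF finite_Basis b] I_def)
    then have "norm (v f - (v f \<bullet> b) *\<^sub>R b) = sqrt (\<Sum>i\<in>Basis. ((\<Sum>j\<in>I. f j *\<^sub>R j) \<bullet> i)\<^sup>2)"
      by (simp only: norm_eq_sqrt_inner) (subst euclidean_inner, simp add: power2_eq_square)
    also have "(\<Sum>i\<in>Basis. ((\<Sum>j\<in>I. f j *\<^sub>R j) \<bullet> i)\<^sup>2) = (\<Sum>i\<in>Basis. if i \<in> I then (f i)\<^sup>2 else 0)"
    proof (rule sum.cong)
      fix i :: 'a assume i: "i \<in> Basis"
      have "(\<Sum>j\<in>I. f j *\<^sub>R j) \<bullet> i = (\<Sum>j\<in>I. if j = i then f i else 0)"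
        unfolding inner_sum_left using i by (intro sum.cong) (auto simp: inner_Basis I_def)
      also have "\<dots> = (if i \<in> I then f i else 0)" using I by simp
      finally show "((\<Sum>j\<in>I. f j *\<^sub>R j) \<bullet> i)\<^sup>2 = (if i \<in> I then (f i)\<^sup>2 else 0)" by simp
    qed simp
    also have "\<dots> = (\<Sum>i\<in>I. (f i)\<^sup>2)"
      by (rule sum.mono_neutral_cong_right) (use I in auto)
    finally show ?thesis .
  qed
  let ?P = "Pi\<^sub>M Basis (\<lambda>_. lborel :: real measure)"
  let ?B = "{f. sqrt (\<Sum>i\<in>I. (f i)\<^sup>2) \<le> r} \<inter> space (Pi\<^sub>M I (\<lambda>_. lborel :: real measure))"
  let ?S = "{f. 0 \<le> f b \<and> f b \<le> 1 \<and> sqrt (\<Sum>i\<in>I. (f i)\<^sup>2) \<le> r} \<inter> space ?P"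
  have cl: "closed (cylinder b r)"
    using compact_cylinder[of b r] b by (simp add: compact_imp_closed)
  have S: "?S \<in> sets ?P" unfolding I(3) by measurable
  have "emeasure lborel (cylinder b r) = emeasure (distr ?P borel v) (cylinder b r)"
    unfolding v_def[abs_def] by (subst lborel_eq) simp
  also have "\<dots> = emeasure ?P (v -` cylinder b r \<inter> space ?P)"
    using cl unfolding v_def[abs_def] by (subst emeasure_distr) auto
  also have "v -` cylinder b r \<inter> space ?P = ?S"
    unfolding cylinder_def vimage_def mem_Collect_eq nrm by (simp add: vb[OF b])
  also have "emeasure ?P ?S = (\<integral>\<^sup>+ f. indicator ?S f \<partial>?P)"
    using S by simp
  also have "\<dots> = (\<integral>\<^sup>+ y. \<integral>\<^sup>+ f. indicator ?S (f(b := y)) \<partial>Pi\<^sub>M I (\<lambda>_. lborel) \<partial>lborel)"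
    using S unfolding I(3) by (intro product_nn_integral_insert_rev I) simp
  also have "\<dots> = (\<integral>\<^sup>+ y. indicator {0..1::real} y * emeasure (Pi\<^sub>M I (\<lambda>_. lborel)) ?B \<partial>lborel)"
  proof (rule nn_integral_cong)
    fix y :: real
    have "(\<integral>\<^sup>+ f. indicator ?S (f(b := y)) \<partial>Pi\<^sub>M I (\<lambda>_. lborel)) =
          (\<integral>\<^sup>+ f. indicator {0..1} y * indicator ?B f \<partial>Pi\<^sub>M I (\<lambda>_. lborel))"
    proof (intro nn_integral_cong)
      fix f assume f: "f \<in> space (Pi\<^sub>M I (\<lambda>_. lborel :: real measure))"
      have sum: "(\<Sum>i\<in>I. ((f(b := y)) i)\<^sup>2) = (\<Sum>i\<in>I. (f i)\<^sup>2)"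
        using I by (intro sum.cong) auto
      have sp: "f(b := y) \<in> space ?P"
        using f unfolding I(3) space_PiM by (intro PiE_fun_upd) auto
      have "f(b := y) \<in> ?S \<longleftrightarrow> y \<in> {0..1} \<and> f \<in> ?B"
        unfolding Int_iff mem_Collect_eq sum using f sp by (simp only: fun_upd_same atLeastAtMost_iff simp_thms conj_assoc)
      then show "indicator ?S (f(b := y)) = (indicator {0..1} y * indicator ?B f :: ennreal)"
        by (simp only: indicator_def) simp
    qed
    also have "\<dots> = indicator {0..1::real} y * emeasure (Pi\<^sub>M I (\<lambda>_. lborel)) ?B"
      using I(1) by (subst nn_integral_cmult) auto
    finally show "(\<integral>\<^sup>+ f. indicator ?S (f(b := y)) \<partial>Pi\<^sub>M I (\<lambda>_. lborel)) = \<dots>" .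
  qed
  also have "\<dots> = emeasure (Pi\<^sub>M I (\<lambda>_. lborel)) ?B"
    by (simp add: nn_integral_multc)
  also have "\<dots> = ennreal (unit_ball_vol (real (card I)) * r ^ card I)"
    using I(1) r by (rule emeasure_cball_aux)
  also have "card I = DIM('a) - 1" using b by (simp add: I_def card_Diff_singleton)
  finally show ?thesis .
qed

lemma orthogonal_transformation_from_axis:
  fixes \<nu> :: "real ^ 'n" and k :: 'n
  assumes "norm \<nu> = 1"
  shows "\<exists>Q. orthogonal_transformation Q \<and> Q (axis k (1::real)) = \<nu>"
proof -
  have "norm (axis k (1::real) :: real ^ 'n) = 1" by (simp add: norm_axis_1)
  from orthogonal_transformation_exists_1[OF this assms] show ?thesis by metis
qed

text \<open>This is the matrix determinant lemma. A rotation carries a coordinate axis to the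
  direction of \<open>v\<close>; in the rotated coordinates the update alters only one column of the
  identity, and Cramer's lemma reads off the determinant.\<close>

lemma det_rank_one_update:
  fixes u v :: "real ^ 'n"
  shows "det (matrix (\<lambda>x. x + (x \<bullet> v) *\<^sub>R u)) = 1 + u \<bullet> v"
proof (cases "v = 0")
  case True
  have "matrix (\<lambda>x. x + (x \<bullet> v) *\<^sub>R u) = mat 1"
    unfolding True by (simp add: matrix_def vec_eq_iff axis_def mat_def)
  then show ?thesis using True by simp
next
  case False
  obtain k :: 'n where True by blast
  define c where "c = norm v"
  obtain Q where Q: "orthogonal_transformation Q" "Q (axis k (1::real)) = v /\<^sub>R c"
    using orthogonal_transformation_from_axis[of "v /\<^sub>R c"] False by (auto simp: c_def)
  have v: "v = c *\<^sub>R Q (axis k (1::real))" using Q False by (simp add: c_def)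
  have linQ: "linear Q" using Q by (simp add: orthogonal_transformation_linear)
  define F where "F = (\<lambda>x. x + (x \<bullet> v) *\<^sub>R u)"
  have linF: "linear F" unfolding F_def by (rule linearI) (auto simp: inner_add_left algebra_simps)
  obtain w where w: "Q w = u" using orthogonal_transformation_surj[OF Q(1)] by (metis surjD)
  define G where "G = (\<lambda>x :: real ^ 'n. x + (c * x $ k) *\<^sub>R w)"
  have linG: "linear G" unfolding G_def by (rule linearI) (auto simp: algebra_simps)
  have "F \<circ> Q = Q \<circ> G"
  proof
    fix x
    have "Q x \<bullet> v = c * x $ k"
      using Q(1) by (simp add: v orthogonal_transformation_def inner_axis)
    then show "(F \<circ> Q) x = (Q \<circ> G) x"
      by (simp add: F_def G_def linear_add[OF linQ] linear_cmul[OF linQ] w)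
  qed
  then have "matrix F ** matrix Q = matrix Q ** matrix G"
    using linF linG linQ by (simp flip: matrix_compose)
  then have "det (matrix F) * det (matrix Q) = det (matrix Q) * det (matrix G)"
    by (metis det_mul)
  moreover have "det (matrix Q) \<noteq> 0"
    using Q(1) by (metis det_orthogonal_matrix orthogonal_transformation_matrix zero_neq_neg_one zero_neq_one)
  ultimately have "det (matrix F) = det (matrix G)" by simp
  also have "matrix G = (\<chi> i j. if j = k then (mat 1 *v (axis k 1 + c *\<^sub>R w)) $ i else mat 1 $ i $ j)"
    unfolding matrix_vector_mul_lid by (simp add: vec_eq_iff matrix_def G_def axis_def mat_def)
  also have "det \<dots> = (axis k 1 + c *\<^sub>R w) $ k"
    by (simp add: cramer_lemma)
  also have "\<dots> = 1 + c * (w \<bullet> axis k 1)"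
  proof -
    have "axis k (1::real) $ k = 1" by (simp add: axis_def)
    then show ?thesis by (simp add: inner_axis)
  qed
  also have "w \<bullet> axis k 1 = u \<bullet> Q (axis k (1::real))"
    using Q(1) w by (metis orthogonal_transformation_def)
  finally show ?thesis by (simp add: F_def v)
qed

lemma measure_cylinder:
  fixes \<nu> :: "real ^ 'n::{finite,wellorder}"
  assumes \<nu>: "norm \<nu> = 1" and r: "r > 0"
  shows "measure lebesgue (cylinder \<nu> r) = unit_ball_vol (real (CARD('n) - 1)) * r ^ (CARD('n) - 1)"
proof -
  obtain k :: 'n where True by blast
  obtain Q where Q: "orthogonal_transformation Q" "Q (axis k (1::real)) = \<nu>"
    using orthogonal_transformation_from_axis[OF \<nu>] by blast
  have linQ: "linear Q" using Q by (simp add: orthogonal_transformation_linear)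
  have b: "axis k (1::real) \<in> Basis" by (simp add: axis_in_Basis_iff)
  have mem: "Q x \<in> cylinder \<nu> r \<longleftrightarrow> x \<in> cylinder (axis k 1) r" for x
  proof -
    have "Q x \<bullet> \<nu> = x \<bullet> axis k 1" using Q by (metis orthogonal_transformation_def)
    moreover have "Q x - (x \<bullet> axis k 1) *\<^sub>R \<nu> = Q (x - (x \<bullet> axis k 1) *\<^sub>R axis k 1)"
      using Q by (simp add: linear_diff[OF linQ] linear_cmul[OF linQ])
    ultimately show ?thesis
      using Q(1) by (simp add: cylinder_def orthogonal_transformation_norm)
  qed
  have "cylinder \<nu> r = Q ` cylinder (axis k 1) r"
  proof (intro equalityI subsetI)
    fix y assume y: "y \<in> cylinder \<nu> r"
    obtain x where "y = Q x" using orthogonal_transformation_surj[OF Q(1)] by (metis surjD)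
    with y mem show "y \<in> Q ` cylinder (axis k 1) r" by auto
  qed (use mem in auto)
  then have "measure lebesgue (cylinder \<nu> r) = measure lebesgue (cylinder (axis k (1::real)) r)"
    using b by (simp add: measure_orthogonal_image[OF Q(1)] lmeasurable_compact compact_cylinder)
  also have "\<dots> = measure lborel (cylinder (axis k (1::real)) r)"
    using b compact_cylinder[of "axis k (1::real)" r] by (simp add: borel_compact)
  also have "\<dots> = unit_ball_vol (real (CARD('n) - 1)) * r ^ (CARD('n) - 1)"
    using emeasure_cylinder_Basis[OF b r] r by (simp add: measure_def)
  finally show ?thesis .
qed

text \<open>The \<open>n\<close>-dimensional volume of \<open>slab_over i S\<close> is the \<open>(n-1)\<close>-dimensional volume of the projection
  of \<open>S\<close> along the \<open>i\<close>-th axis. This encoding avoids a type for \<open>(n-1)\<close>-dimensional space.\<close>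

definition slab_over :: "'n \<Rightarrow> (real ^ 'n) set \<Rightarrow> (real ^ 'n) set" where
  "slab_over i S = {x. 0 \<le> x $ i \<and> x $ i \<le> 1 \<and> (\<exists>y\<in>S. \<forall>j. j \<noteq> i \<longrightarrow> y $ j = x $ j)}"

lemma slab_over_eq_image:
  "slab_over i S = (\<lambda>(y, s). y + (s - y $ i) *\<^sub>R axis i 1) ` (S \<times> {0..1})" (is "_ = ?R")
proof (intro equalityI subsetI)
  fix x assume "x \<in> slab_over i S"
  then obtain y where y: "0 \<le> x $ i" "x $ i \<le> 1" "y \<in> S" "\<And>j. j \<noteq> i \<Longrightarrow> y $ j = x $ j"
    by (auto simp: slab_over_def)
  then have "x = y + (x $ i - y $ i) *\<^sub>R axis i 1"
    by (auto simp: vec_eq_iff axis_def)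
  with y show "x \<in> ?R" by (intro image_eqI[of _ _ "(y, x $ i)"]) auto
qed (auto simp: slab_over_def axis_def)

lemma compact_slab_over:
  assumes "compact S"
  shows "compact (slab_over i S)"
  unfolding slab_over_eq_image
  by (intro compact_continuous_image compact_Times assms compact_Icc)
     (auto simp: case_prod_beta intro!: continuous_intros)

definition disc :: "'a::euclidean_space \<Rightarrow> real \<Rightarrow> 'a set" where
  "disc \<nu> r = {t. t \<bullet> \<nu> = 0 \<and> norm t \<le> r}"

text \<open>The slab over a disc of normal \<open>\<nu>\<close> is a linear image of the right cylinder over that disc. The map
  is a product of two rank-one updates, of determinants \<open>\<nu> $ i\<close> and \<open>1\<close>.\<close>

lemma measure_slab_over_disc:
  fixes \<nu> :: "real ^ 'n::{finite,wellorder}"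
  assumes \<nu>: "norm \<nu> = 1" and r: "r > 0" and i: "\<nu> $ i > 0"
  shows "measure lebesgue (slab_over i (disc \<nu> r)) =
     \<nu> $ i * (unit_ball_vol (real (CARD('n) - 1)) * r ^ (CARD('n) - 1))"
proof -
  define e where "e = axis i (1::real)"
  \<comment> \<open>\<open>M\<close> fixes the hyperplane of the disc and tilts the axis of the
    cylinder from \<open>\<nu>\<close> to \<open>e\<close>.\<close>
  define M where "M = (\<lambda>x. x + (x \<bullet> \<nu>) *\<^sub>R (e - \<nu>))"
  \<comment> \<open>\<open>v\<close> is orthogonal to \<open>e\<close>, so \<open>N\<close> is a
    shear along \<open>e\<close>; on the hyperplane it subtracts the \<open>i\<close>-th coordinate,
    which levels the base of the tilted cylinder to height 0.\<close>
  define v where "v = (1 / \<nu> $ i) *\<^sub>R \<nu> - e"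
  define N where "N = (\<lambda>x. x + (x \<bullet> v) *\<^sub>R e)"
  have e\<nu>: "e \<bullet> \<nu> = \<nu> $ i" "x \<bullet> e = x $ i" "e \<bullet> e = 1" "\<nu> \<bullet> \<nu> = 1" "e $ i = 1" for x
    using \<nu> by (simp_all add: e_def inner_axis inner_axis' norm_eq_1)
  have lin: "linear M" "linear N"
    unfolding M_def N_def by (auto intro!: linearI simp: inner_add_left algebra_simps)
  have M: "M (t + s *\<^sub>R \<nu>) = t + s *\<^sub>R e" if "t \<bullet> \<nu> = 0" for t s
    using that by (simp add: M_def inner_add_left e\<nu> algebra_simps)
  have N: "N (t + s *\<^sub>R e) = t + (s - t $ i) *\<^sub>R e" if "t \<bullet> \<nu> = 0" for t s
  proof -
    have "(t + s *\<^sub>R e) \<bullet> v = - t $ i"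
      using that i by (simp add: v_def inner_add_left inner_diff_right e\<nu>)
    then show ?thesis by (simp add: N_def algebra_simps)
  qed
  have "slab_over i (disc \<nu> r) = N ` M ` cylinder \<nu> r"
  proof (intro equalityI subsetI)
    fix x assume "x \<in> slab_over i (disc \<nu> r)"
    then obtain t s where t: "t \<in> disc \<nu> r" "0 \<le> s" "s \<le> 1" "x = t + (s - t $ i) *\<^sub>R e"
      by (auto simp: slab_over_eq_image e_def)
    then have t\<nu>: "t \<bullet> \<nu> = 0" by (simp add: disc_def)
    then have "(t + s *\<^sub>R \<nu>) \<bullet> \<nu> = s" by (simp add: inner_add_left e\<nu>)
    then have "t + s *\<^sub>R \<nu> \<in> cylinder \<nu> r"
      using t by (simp add: cylinder_def disc_def)
    moreover have "x = N (M (t + s *\<^sub>R \<nu>))" using t M[OF t\<nu>] N[OF t\<nu>] by simp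
    ultimately show "x \<in> N ` M ` cylinder \<nu> r" by blast
  next
    fix x assume "x \<in> N ` M ` cylinder \<nu> r"
    then obtain y where y: "y \<in> cylinder \<nu> r" "x = N (M y)" by blast
    define s where "s = y \<bullet> \<nu>"
    define t where "t = y - s *\<^sub>R \<nu>"
    have t\<nu>: "t \<bullet> \<nu> = 0" by (simp add: t_def s_def inner_diff_left e\<nu>)
    have "y = t + s *\<^sub>R \<nu>" by (simp add: t_def)
    then have "x = t + (s - t $ i) *\<^sub>R e" using y M[OF t\<nu>] N[OF t\<nu>] by simp
    moreover have "t \<in> disc \<nu> r" "0 \<le> s" "s \<le> 1"
      using y t\<nu> by (auto simp: cylinder_def disc_def t_def s_def)
    ultimately show "x \<in> slab_over i (disc \<nu> r)"
      unfolding slab_over_eq_image e_def by (intro image_eqI[of _ _ "(t, s)"]) auto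
  qed
  moreover have "det (matrix M) = \<nu> $ i"
    unfolding M_def det_rank_one_update by (simp add: inner_diff_left e\<nu>)
  moreover have "det (matrix N) = 1"
    using i unfolding N_def det_rank_one_update by (simp add: v_def inner_diff_right e\<nu>)
  moreover have "cylinder \<nu> r \<in> lmeasurable"
    using \<nu> by (simp add: compact_cylinder lmeasurable_compact)
  ultimately show ?thesis
    using lin i by (simp add: measure_linear_image measurable_linear_image measure_cylinder[OF \<nu> r])
qed

section \<open>Hausdorff measure\<close>

text \<open>A countable family is padded to a sequence with empty sets, which have weight 0 even for
  \<open>s = 0\<close>. Since weights are nonnegative, bounds on finite partial sums
  suffice.\<close>

lemma hausdorff_premeasure_le:
  assumes "countable I" "A \<subseteq> (\<Union>i\<in>I. B i)" "\<delta> \<ge> 0"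
    and diam: "\<And>i. i \<in> I \<Longrightarrow> bounded (B i) \<and> diameter (B i) \<le> \<delta>"
    and sum: "\<And>J. finite J \<Longrightarrow> J \<subseteq> I \<Longrightarrow> (\<Sum>i\<in>J. hausdorff_weight s (B i)) \<le> c"
  shows "hausdorff_premeasure s \<delta> A \<le> c"
proof -
  define g where "g = inv_into I (to_nat_on I)"
  define N where "N = to_nat_on I ` I"
  have inj: "inj_on (to_nat_on I) I" using \<open>countable I\<close> by (rule inj_on_to_nat_on)
  have gI: "g n \<in> I" if "n \<in> N" for n
    using that unfolding g_def N_def by (rule inv_into_into)
  have inj_g: "inj_on g N" unfolding g_def N_def by (rule inj_on_inv_into) simp
  define C where "C n = (if n \<in> N then B (g n) else {})" for n
  have "A \<subseteq> (\<Union>n. C n)"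
  proof
    fix x assume "x \<in> A"
    then obtain i where i: "i \<in> I" "x \<in> B i" using assms(2) by blast
    then have "x \<in> C (to_nat_on I i)"
      by (simp add: C_def N_def g_def inv_into_f_f[OF inj])
    then show "x \<in> (\<Union>n. C n)" by blast
  qed
  moreover have "bounded (C n) \<and> diameter (C n) \<le> \<delta>" for n
    using diam[OF gI] \<open>\<delta> \<ge> 0\<close> by (auto simp: C_def)
  ultimately have "hausdorff_premeasure s \<delta> A \<le> (\<Sum>n. hausdorff_weight s (C n))"
    unfolding hausdorff_premeasure_def by (intro INF_lower) auto
  also have "\<dots> \<le> c"
  proof (rule suminf_le_const)
    fix k
    have "(\<Sum>n<k. hausdorff_weight s (C n)) = (\<Sum>n\<in>{..<k} \<inter> N. hausdorff_weight s (B (g n)))"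
      by (rule sum.mono_neutral_cong_right) (auto simp: C_def hausdorff_weight_def)
    also have "\<dots> = (\<Sum>i\<in>g ` ({..<k} \<inter> N). hausdorff_weight s (B i))"
      using inj_g by (subst sum.reindex) (auto intro: inj_on_subset)
    also have "\<dots> \<le> c" using gI by (intro sum) auto
    finally show "(\<Sum>n<k. hausdorff_weight s (C n)) \<le> c" .
  qed simp
  finally show ?thesis .
qed

lemma hausdorff_premeasure_mono:
  "A \<subseteq> B \<Longrightarrow> hausdorff_premeasure s \<delta> A \<le> hausdorff_premeasure s \<delta> B"
  unfolding hausdorff_premeasure_def by (intro INF_superset_mono) auto

lemma ennreal_less_add_pos: "x \<noteq> top \<Longrightarrow> e > 0 \<Longrightarrow> x < x + ennreal e"
  by (cases x) (auto simp: ennreal_less_iff simp flip: ennreal_plus)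

text \<open>Near-optimal covers of \<open>A\<close> and \<open>B\<close> together form one cover,
  indexed by the sum type.\<close>

lemma hausdorff_premeasure_Un:
  assumes "\<delta> \<ge> 0"
  shows "hausdorff_premeasure s \<delta> (A \<union> B) \<le> hausdorff_premeasure s \<delta> A + hausdorff_premeasure s \<delta> B"
proof -
  have "hausdorff_premeasure s \<delta> (A \<union> B) \<le> a + b"
    if a: "hausdorff_premeasure s \<delta> A < a" and b: "hausdorff_premeasure s \<delta> B < b" for a b
  proof -
    obtain C where C: "A \<subseteq> (\<Union>j. C j)" "\<And>j::nat. bounded (C j) \<and> diameter (C j) \<le> \<delta>"
      "(\<Sum>j. hausdorff_weight s (C j)) < a"
      using a unfolding hausdorff_premeasure_def INF_less_iff by blast
    obtain D where D: "B \<subseteq> (\<Union>j. D j)" "\<And>j::nat. bounded (D j) \<and> diameter (D j) \<le> \<delta>"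
      "(\<Sum>j. hausdorff_weight s (D j)) < b"
      using b unfolding hausdorff_premeasure_def INF_less_iff by blast
    show ?thesis
    proof (rule hausdorff_premeasure_le[where I = UNIV and B = "case_sum C D"])
      show "A \<union> B \<subseteq> (\<Union>i\<in>UNIV. case_sum C D i)"
      proof
        fix x assume "x \<in> A \<union> B"
        then consider j where "x \<in> C j" | j where "x \<in> D j" using C(1) D(1) by blast
        then show "x \<in> (\<Union>i\<in>UNIV. case_sum C D i)"
        proof cases
          case (1 j)
          then show ?thesis by (intro UN_I[of "Inl j"]) auto
        next
          case (2 j)
          then show ?thesis by (intro UN_I[of "Inr j"]) auto
        qed
      qed
      fix i show "bounded (case_sum C D i) \<and> diameter (case_sum C D i) \<le> \<delta>"
        using C(2) D(2) by (cases i) auto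
    next
      fix J :: "(nat + nat) set" assume "finite J"
      define J1 where "J1 = Inl -` J"
      define J2 where "J2 = Inr -` J"
      have fin: "finite J1" "finite J2"
        using \<open>finite J\<close> by (auto simp: J1_def J2_def intro!: finite_vimageI)
      have J: "J = Inl ` J1 \<union> Inr ` J2"
        by (auto simp: J1_def J2_def image_iff) (metis sum.exhaust)
      have "(\<Sum>i\<in>J. hausdorff_weight s (case_sum C D i)) =
        (\<Sum>j\<in>J1. hausdorff_weight s (C j)) + (\<Sum>j\<in>J2. hausdorff_weight s (D j))"
        unfolding J using fin by (subst sum.union_disjoint) (auto simp: sum.reindex)
      also have "\<dots> \<le> a + b"
        using C(3) D(3) fin by (intro add_mono order_trans[OF sum_le_suminf less_imp_le]) auto
      finally show "(\<Sum>i\<in>J. hausdorff_weight s (case_sum C D i)) \<le> a + b" .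
    qed (use assms in auto)
  qed
  note less = this
  show ?thesis
  proof (cases "hausdorff_premeasure s \<delta> A = top \<or> hausdorff_premeasure s \<delta> B = top")
    case False
    show ?thesis
    proof (rule ennreal_le_epsilon)
      fix e :: real assume "0 < e"
      let ?a = "hausdorff_premeasure s \<delta> A" and ?b = "hausdorff_premeasure s \<delta> B"
      have "?a < ?a + ennreal (e / 2)" "?b < ?b + ennreal (e / 2)"
        using False \<open>0 < e\<close> by (auto intro!: ennreal_less_add_pos)
      from less[OF this] have "hausdorff_premeasure s \<delta> (A \<union> B) \<le> (?a + ?b) + (ennreal (e / 2) + ennreal (e / 2))"
        by (simp add: ac_simps)
      also have "ennreal (e / 2) + ennreal (e / 2) = ennreal e"
        using \<open>0 < e\<close> by (simp flip: ennreal_plus)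
      finally show "hausdorff_premeasure s \<delta> (A \<union> B) \<le> ?a + ?b + ennreal e" .
    qed
  qed auto
qed

lemma hausdorff_measure_leI:
  assumes "\<And>\<delta>. \<delta> > 0 \<Longrightarrow> hausdorff_premeasure s \<delta> A \<le> c"
  shows "hausdorff_measure s A \<le> c"
  unfolding hausdorff_measure_eq_SUP using assms by (intro SUP_least) auto

lemma hausdorff_premeasure_le_measure:
  "\<delta> > 0 \<Longrightarrow> hausdorff_premeasure s \<delta> A \<le> hausdorff_measure s A"
  unfolding hausdorff_measure_eq_SUP by (intro SUP_upper) auto

lemma hausdorff_measure_mono: "A \<subseteq> B \<Longrightarrow> hausdorff_measure s A \<le> hausdorff_measure s B"
  by (meson hausdorff_measure_leI hausdorff_premeasure_le_measure hausdorff_premeasure_mono order_trans)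

lemma hausdorff_measure_Un: "hausdorff_measure s (A \<union> B) \<le> hausdorff_measure s A + hausdorff_measure s B"
proof (rule hausdorff_measure_leI)
  fix \<delta> :: real assume "\<delta> > 0"
  then have "hausdorff_premeasure s \<delta> (A \<union> B) \<le> hausdorff_premeasure s \<delta> A + hausdorff_premeasure s \<delta> B"
    by (intro hausdorff_premeasure_Un) simp
  also have "\<dots> \<le> hausdorff_measure s A + hausdorff_measure s B"
    using \<open>\<delta> > 0\<close> by (intro add_mono hausdorff_premeasure_le_measure)
  finally show "hausdorff_premeasure s \<delta> (A \<union> B) \<le> hausdorff_measure s A + hausdorff_measure s B" .
qed

lemma hausdorff_measure_empty [simp]: "hausdorff_measure s {} = 0"
proof -
  have "hausdorff_measure s {} \<le> (0::ennreal)"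
    by (rule hausdorff_measure_leI) (rule hausdorff_premeasure_le[where I = "{}"], auto)
  then show ?thesis by simp
qed

lemma hausdorff_measure_UN:
  assumes "finite I"
  shows "hausdorff_measure s (\<Union>i\<in>I. A i) \<le> (\<Sum>i\<in>I. hausdorff_measure s (A i))"
  using assms
proof (induction I rule: finite_induct)
  case (insert i I)
  have "hausdorff_measure s (\<Union>i\<in>insert i I. A i) \<le> hausdorff_measure s (A i) + hausdorff_measure s (\<Union>i\<in>I. A i)"
    using hausdorff_measure_Un[of s "A i"] by simp
  also have "\<dots> \<le> hausdorff_measure s (A i) + (\<Sum>i\<in>I. hausdorff_measure s (A i))"
    using insert.IH by (rule add_left_mono)
  finally show ?case using insert.hyps by simp
qed simp

lemma hausdorff_measure_isometry_image_le:
  fixes f :: "'a::metric_space \<Rightarrow> 'b::metric_space"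
  assumes f: "\<And>x y. dist (f x) (f y) = dist x y"
  shows "hausdorff_measure s (f ` A) \<le> hausdorff_measure s A"
proof -
  have bounded: "bounded (f ` C)" if "bounded C" for C
  proof -
    obtain x e where "\<And>y. y \<in> C \<Longrightarrow> dist x y \<le> e" using \<open>bounded C\<close> by (auto simp: bounded_def)
    then show ?thesis by (auto simp: bounded_def f intro!: exI[of _ "f x"] exI[of _ e])
  qed
  have diameter: "diameter (f ` C) = diameter C" for C
  proof -
    have "(\<lambda>(x, y). dist x y) ` (f ` C \<times> f ` C) = (\<lambda>(x, y). dist x y) ` (C \<times> C)"
      by (force simp: f image_iff)
    then show ?thesis by (simp add: diameter_def)
  qed
  have weight: "hausdorff_weight s (f ` C) = hausdorff_weight s C" for C
    by (simp add: hausdorff_weight_def diameter)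
  show ?thesis
  proof (rule hausdorff_measure_leI)
    fix \<delta> :: real assume "\<delta> > 0"
    have "hausdorff_premeasure s \<delta> (f ` A) \<le> hausdorff_premeasure s \<delta> A"
      unfolding hausdorff_premeasure_def[of s \<delta> A]
    proof (rule INF_greatest)
      fix C :: "nat \<Rightarrow> 'a set" assume "C \<in> {C. A \<subseteq> (\<Union>j. C j) \<and> (\<forall>j. bounded (C j) \<and> diameter (C j) \<le> \<delta>)}"
      then have C: "A \<subseteq> (\<Union>j. C j)" "\<And>j. bounded (C j)" "\<And>j. diameter (C j) \<le> \<delta>" by auto
      have "f ` A \<subseteq> (\<Union>j. f ` C j)" using C(1) by blast
      then have "hausdorff_premeasure s \<delta> (f ` A) \<le> (\<Sum>j. hausdorff_weight s (f ` C j))"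
        unfolding hausdorff_premeasure_def
        by (intro INF_lower) (simp add: diameter bounded C)
      then show "hausdorff_premeasure s \<delta> (f ` A) \<le> (\<Sum>j. hausdorff_weight s (C j))"
        by (simp add: weight)
    qed
    also have "\<dots> \<le> hausdorff_measure s A"
      using \<open>\<delta> > 0\<close> by (rule hausdorff_premeasure_le_measure)
    finally show "hausdorff_premeasure s \<delta> (f ` A) \<le> hausdorff_measure s A" .
  qed
qed

section \<open>Covers by balls\<close>

text \<open>The weight depends on the radius and on \<open>m\<close> but not on the ambient
  dimension: it is the volume of an \<open>m\<close>-dimensional disc, the quantity with which the
  projections are compared below.\<close>

lemma hausdorff_weight_cball:
  fixes x :: "'a::euclidean_space"
  assumes "r > 0"
  shows "hausdorff_weight (real m) (cball x r) = ennreal (unit_ball_vol (real m) * r ^ m)"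
  using assms by (simp add: hausdorff_weight_def powr_realpow)

text \<open>Choose disjoint balls whose fivefold enlargements cover \<open>S\<close>. All but finitely many of them have a
  small total weight, so only these need enlarging; a point outside the finitely many others lies in the
  enlargement of one of the rest. No Lebesgue measure on \<open>S\<close> is needed.\<close>

lemma hausdorff_premeasure_Vitali:
  fixes S :: "'a::euclidean_space set"
  assumes "\<delta> > 0" "M \<ge> 0"
    and fine: "\<And>x d. x \<in> S \<Longrightarrow> d > 0 \<Longrightarrow> \<exists>r. 0 < r \<and> r < d \<and> Q x r"
    and sum: "\<And>J. finite J \<Longrightarrow> (\<And>x r. (x, r) \<in> J \<Longrightarrow> x \<in> S \<and> 0 < r \<and> r < \<delta> \<and> Q x r) \<Longrightarrow>
      pairwise (\<lambda>i j. disjnt (cball (fst i) (snd i)) (cball (fst j) (snd j))) J \<Longrightarrow>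
      (\<Sum>i\<in>J. unit_ball_vol (real m) * snd i ^ m) \<le> M"
  shows "hausdorff_premeasure (real m) \<delta> S \<le> ennreal M"
proof -
  \<comment> \<open>Radii below \<open>\<delta> / 10\<close> keep the fivefold balls at diameter at
    most \<open>\<delta>\<close>.\<close>
  define K where "K = {(x, r). x \<in> S \<and> 0 < r \<and> r < \<delta> / 10 \<and> Q x r}"
  obtain C where C: "countable C" "C \<subseteq> K"
     "pairwise (\<lambda>i j. disjnt (cball (fst i) (snd i)) (cball (fst j) (snd j))) C"
     "\<And>i. i \<in> K \<Longrightarrow> \<exists>j. j \<in> C \<and> \<not> disjnt (cball (fst i) (snd i)) (cball (fst j) (snd j)) \<and>
                        cball (fst i) (snd i) \<subseteq> ball (fst j) (5 * snd j)"
  proof (rule Vitali_covering_lemma_cballs_balls[of K snd "\<delta> / 10" fst])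
    show "0 < snd i \<and> snd i \<le> \<delta> / 10" if "i \<in> K" for i
      using that by (auto simp: K_def)
  qed blast
  have CK: "fst i \<in> S" "0 < snd i" "snd i < \<delta> / 10" "Q (fst i) (snd i)" if "i \<in> C" for i
    using that C(2) by (auto simp: K_def)
  define W where "W i = unit_ball_vol (real m) * snd i ^ m" for i :: "'a \<times> real"
  have W0: "W i \<ge> 0" if "i \<in> C" for i using CK(2)[OF that] by (simp add: W_def)
  have WM: "sum W J \<le> M" if J: "finite J" "J \<subseteq> C" for J
    unfolding W_def
  proof (rule sum[OF J(1)])
    show "x \<in> S \<and> 0 < r \<and> r < \<delta> \<and> Q x r" if "(x, r) \<in> J" for x r
      using CK[of "(x, r)"] that J(2) \<open>\<delta> > 0\<close> by auto
    show "pairwise (\<lambda>i j. disjnt (cball (fst i) (snd i)) (cball (fst j) (snd j))) J"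
      using C(3) J(2) by (rule pairwise_subset)
  qed
  define X where "X = {sum W J |J. finite J \<and> J \<subseteq> C}"
  have X: "X \<noteq> {}" "bdd_above X"
    using WM by (auto simp: X_def bdd_above_def)
  show ?thesis
  proof (rule ennreal_le_epsilon)
    fix e :: real assume "0 < e"
    \<comment> \<open>Fivefold enlargement multiplies weights by \<open>5 ^ m\<close>, so a tail of
      weight at most \<open>\<epsilon>\<close> costs at most \<open>e\<close> after
      enlargement.\<close>
    define \<epsilon> where "\<epsilon> = e / 5 ^ m"
    have "\<epsilon> > 0" using \<open>0 < e\<close> by (simp add: \<epsilon>_def)
    then obtain J0 where J0: "finite J0" "J0 \<subseteq> C" "Sup X - \<epsilon> < sum W J0"
      using less_cSupE[OF _ X(1), of "Sup X - \<epsilon>"] by (auto simp: X_def)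
    have tail: "sum W J \<le> \<epsilon>" if J: "finite J" "J \<subseteq> C - J0" for J
    proof -
      have "sum W J0 + sum W J = sum W (J0 \<union> J)"
        using J J0 by (intro sum.union_disjoint[symmetric]) auto
      also have "\<dots> \<le> Sup X"
        using J J0 by (intro cSup_upper X) (auto simp: X_def)
      finally show ?thesis using J0(3) by simp
    qed
    define B where "B i = (if i \<in> J0 then cball (fst i) (snd i) else cball (fst i) (5 * snd i))" for i :: "'a \<times> real"
    have "hausdorff_premeasure (real m) \<delta> S \<le> ennreal (M + e)"
    proof (rule hausdorff_premeasure_le[where I = C and B = B])
      show "S \<subseteq> (\<Union>i\<in>C. B i)"
      proof
        fix x assume x: "x \<in> S"
        show "x \<in> (\<Union>i\<in>C. B i)"
        proof (cases "x \<in> (\<Union>i\<in>J0. cball (fst i) (snd i))")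
          case True
          then show ?thesis using J0(2) by (auto simp: B_def)
        next
          case False
          have "open (- (\<Union>i\<in>J0. cball (fst i) (snd i)))" using J0(1) by (intro open_Compl closed_UN) auto
          then have "\<exists>d>0. cball x d \<subseteq> - (\<Union>i\<in>J0. cball (fst i) (snd i))"
            by (rule open_contains_cball[THEN iffD1, rule_format]) (use False in simp)
          then obtain d where d: "d > 0" "cball x d \<subseteq> - (\<Union>i\<in>J0. cball (fst i) (snd i))"
            by blast
          obtain r where r: "0 < r" "r < min d (\<delta> / 10)" "Q x r"
            using fine[OF x, of "min d (\<delta> / 10)"] d \<open>\<delta> > 0\<close> by auto
          then have "(x, r) \<in> K" using x by (simp add: K_def)
          obtain j where j: "j \<in> C" "\<not> disjnt (cball x r) (cball (fst j) (snd j))"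
            "cball x r \<subseteq> ball (fst j) (5 * snd j)"
            using C(4)[OF \<open>(x, r) \<in> K\<close>] by auto
          have "j \<notin> J0"
          proof
            assume "j \<in> J0"
            then have "disjnt (cball x d) (cball (fst j) (snd j))" using d(2) unfolding disjnt_def by blast
            moreover have "cball x r \<subseteq> cball x d" using r by (intro subset_cball) simp
            ultimately show False using j(2) by (meson disjnt_subset1)
          qed
          moreover have "x \<in> cball (fst j) (5 * snd j)"
            using j(3) r(1) ball_subset_cball by (meson centre_in_cball less_imp_le subsetD)
          ultimately show ?thesis using j(1) by (auto simp: B_def)
        qed
      qed
      show "bounded (B i) \<and> diameter (B i) \<le> \<delta>" if "i \<in> C" for i
        using CK(2,3)[OF that] by (auto simp: B_def)
      fix J assume J: "finite J" "J \<subseteq> C"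
      have "(\<Sum>i\<in>J. hausdorff_weight (real m) (B i)) = (\<Sum>i\<in>J. ennreal (if i \<in> J0 then W i else 5 ^ m * W i))"
      proof (rule sum.cong)
        fix i assume "i \<in> J"
        then have "snd i > 0" using J(2) CK(2) by blast
        then show "hausdorff_weight (real m) (B i) = ennreal (if i \<in> J0 then W i else 5 ^ m * W i)"
          by (simp add: B_def W_def hausdorff_weight_cball power_mult_distrib mult_ac)
      qed simp
      also have "\<dots> = ennreal (\<Sum>i\<in>J. if i \<in> J0 then W i else 5 ^ m * W i)"
        using J W0 by (intro sum_ennreal) auto
      also have "(\<Sum>i\<in>J. if i \<in> J0 then W i else 5 ^ m * W i) = sum W (J \<inter> J0) + 5 ^ m * sum W (J - J0)"
        using J(1) by (simp add: sum.If_cases sum_distrib_left Diff_eq)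
      also have "\<dots> \<le> M + 5 ^ m * \<epsilon>"
        using J J0 by (intro add_mono mult_left_mono WM tail) auto
      also have "\<dots> = M + e" by (simp add: \<epsilon>_def)
      finally show "(\<Sum>i\<in>J. hausdorff_weight (real m) (B i)) \<le> ennreal (M + e)"
        by (simp add: ennreal_leI)
    qed (use C \<open>\<delta> > 0\<close> in auto)
    then show "hausdorff_premeasure (real m) \<delta> S \<le> ennreal M + ennreal e"
      using \<open>M \<ge> 0\<close> \<open>0 < e\<close> by (simp flip: ennreal_plus)
  qed
qed

section \<open>Level sets of antitone functions\<close>

text \<open>These two laws are all that the study of the surface uses of the function built from an
  antichain. Here \<open>1\<close> is the vector with all entries 1.\<close>

locale antitone_translation =
  fixes F :: "real ^ 'n::{finite,wellorder} \<Rightarrow> real"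
  assumes antitone: "x \<le> y \<Longrightarrow> F y \<le> F x"
    and translation: "F (x + t *\<^sub>R 1) = F x - t"
begin

definition \<Gamma> :: "(real, 'n) vec set" where
  "\<Gamma> = {x. F x = 0}"

text \<open>For positive \<open>t\<close> it shows that two points of \<open>\<Gamma>\<close> cannot
  differ by at least \<open>t\<close> in every coordinate; for \<open>t = - norm (x - y)\<close> it
  yields the Lipschitz bound.\<close>

lemma strict_decrease:
  assumes "\<And>i. x $ i + t \<le> y $ i"
  shows "F y \<le> F x - t"
proof -
  have "x + t *\<^sub>R 1 \<le> y" using assms by (simp add: less_eq_vec_def)
  then show ?thesis using antitone translation by metis
qed

lemma Lipschitz: "1-lipschitz_on UNIV F"
proof (rule lipschitz_onI)
  fix x y
  have "F y \<le> F x - (- norm (x - y))" for x y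
  proof (rule strict_decrease)
    show "x $ i + - norm (x - y) \<le> y $ i" for i
      using component_le_norm_cart[of "x - y" i] by simp
  qed
  from this[of x y] this[of y x] show "dist (F x) (F y) \<le> 1 * dist x y"
    by (simp add: dist_real_def dist_norm norm_minus_commute)
qed simp

lemma Lipschitz_le: "\<bar>F x - F y\<bar> \<le> norm (x - y)"
  using lipschitz_onD[OF Lipschitz, of x y] by (simp add: dist_norm)

lemma continuous: "continuous_on S F"
  using lipschitz_on_continuous_on[OF Lipschitz] continuous_on_subset by blast

lemma closed_\<Gamma>: "closed \<Gamma>"
  unfolding \<Gamma>_def by (intro closed_Collect_eq continuous_intros continuous)

text \<open>\<open>F\<close> agrees up to a constant with its translate along the diagonal, so
  differentiability is constant on diagonal lines.\<close>

lemma differentiable_translate: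
  assumes "F differentiable at (x + t *\<^sub>R 1)"
  shows "F differentiable at x"
proof -
  have "(\<lambda>y. F (y + t *\<^sub>R 1) + t) differentiable at x"
    by (intro differentiable_add differentiable_compose[where f = F and g = "\<lambda>y. y + t *\<^sub>R 1"] assms) auto
  moreover have "(\<lambda>y. F (y + t *\<^sub>R 1) + t) = F" by (simp add: translation)
  ultimately show ?thesis by simp
qed

text \<open>If the fibre of \<open>\<Gamma>\<close> in direction \<open>i\<close> over \<open>x\<close> has two points, it contains a segment with rational
  end heights \<open>q < q'\<close>. For fixed \<open>q, q'\<close> this happens at most once on each line in the diagonal direction
  \<open>1 - axis i 1\<close>, since otherwise \<open>\<Gamma>\<close> would contain two points that differ strictly in every
  coordinate.\<close>

lemma negligible_slab_overlap:
  assumes "S \<subseteq> \<Gamma>" "T \<subseteq> \<Gamma>" "S \<inter> T = {}"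
  shows "negligible (slab_over i S \<inter> slab_over i T)"
proof -
  define upd where "upd x s = x + (s - x $ i) *\<^sub>R axis i 1" for x :: "(real, 'n) vec" and s
  have upd: "upd x s $ j = (if j = i then s else x $ j)" for x s j
    by (simp add: upd_def axis_def)
  define Z where "Z = (\<lambda>(q, q'). {x. F (upd x q) = 0} \<inter> {x. F (upd x q') = 0})"
  have "negligible (Z (q, q'))" if "q < q'" for q q'
  proof (rule negligible_if_negligible_on_lines[where e = "1 - axis i 1"])
    have "closed {x. F (upd x q) = 0}" for q
      unfolding upd_def
      by (intro closed_Collect_eq continuous_on_compose2[OF continuous[of UNIV]] continuous_intros) auto
    then show "Z (q, q') \<in> sets borel" by (auto simp: Z_def)
    fix x
    have "\<not> (t < t' \<and> x + t *\<^sub>R (1 - axis i 1) \<in> Z (q, q') \<and> x + t' *\<^sub>R (1 - axis i 1) \<in> Z (q, q'))" for t t'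
    proof
      assume *: "t < t' \<and> x + t *\<^sub>R (1 - axis i 1) \<in> Z (q, q') \<and> x + t' *\<^sub>R (1 - axis i 1) \<in> Z (q, q')"
      \<comment> \<open>The second point exceeds the first by \<open>q' - q\<close> in coordinate
        \<open>i\<close> and by \<open>t' - t\<close> in all others.\<close>
      have "F (upd (x + t' *\<^sub>R (1 - axis i 1)) q') \<le> F (upd (x + t *\<^sub>R (1 - axis i 1)) q) - min (t' - t) (q' - q)"
        by (rule strict_decrease) (auto simp: upd axis_def)
      with * \<open>q < q'\<close> show False by (auto simp: Z_def)
    qed
    then have "{t. x + t *\<^sub>R (1 - axis i 1) \<in> Z (q, q')} \<subseteq> {SOME t. x + t *\<^sub>R (1 - axis i 1) \<in> Z (q, q')}"
      by (metis (mono_tags, lifting) linorder_less_linear mem_Collect_eq singletonI someI subsetI)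
    then show "negligible {t. x + t *\<^sub>R (1 - axis i 1) \<in> Z (q, q')}"
      using negligible_subset negligible_sing by blast
  qed
  then have "negligible (\<Union>(Z ` {(q, q'). q \<in> \<rat> \<and> q' \<in> \<rat> \<and> q < q'}))"
  proof (intro negligible_countable_Union countable_image)
    have "{(q, q'). q \<in> \<rat> \<and> q' \<in> \<rat> \<and> q < (q'::real)} \<subseteq> \<rat> \<times> \<rat>" by auto
    then show "countable {(q, q'). q \<in> \<rat> \<and> q' \<in> \<rat> \<and> q < (q'::real)}"
      by (rule countable_subset) (intro countable_SIGMA countable_rat)
  qed auto
  moreover have "slab_over i S \<inter> slab_over i T \<subseteq> \<Union>(Z ` {(q, q'). q \<in> \<rat> \<and> q' \<in> \<rat> \<and> q < q'})"
  proof
    fix x assume "x \<in> slab_over i S \<inter> slab_over i T"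
    then obtain y z where y: "y \<in> S" "\<And>j. j \<noteq> i \<Longrightarrow> y $ j = x $ j" and z: "z \<in> T" "\<And>j. j \<noteq> i \<Longrightarrow> z $ j = x $ j"
      unfolding slab_over_def by blast
    have yz: "y = upd x (y $ i)" "z = upd x (z $ i)"
      using y(2) z(2) by (auto simp: vec_eq_iff upd)
    have F0: "F y = 0" "F z = 0" using y(1) z(1) assms by (auto simp: \<Gamma>_def)
    have "y \<noteq> z" using y(1) z(1) assms(3) by blast
    then have ne: "y $ i \<noteq> z $ i" using yz by metis
    have mono: "F (upd x s') \<le> F (upd x s)" if "s \<le> s'" for s s'
      using that by (intro antitone) (auto simp: less_eq_vec_def upd)
    define a where "a = min (y $ i) (z $ i)"
    define b where "b = max (y $ i) (z $ i)"
    have ab: "a < b" "F (upd x a) = 0" "F (upd x b) = 0"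
      using ne F0 yz by (auto simp: a_def b_def min_def max_def)
    obtain q' where q': "q' \<in> \<rat>" "a < q'" "q' < b" using Rats_dense_in_real[OF ab(1)] by blast
    obtain q where q: "q \<in> \<rat>" "a < q" "q < q'" using Rats_dense_in_real[OF q'(2)] by blast
    \<comment> \<open>\<open>F\<close> is antitone along the fibre and vanishes at heights
      \<open>a\<close> and \<open>b\<close>, hence at every height in between.\<close>
    have "F (upd x q) = 0" "F (upd x q') = 0"
      using mono[of a q] mono[of q b] mono[of a q'] mono[of q' b] ab q q' by auto
    then have "x \<in> Z (q, q')" by (simp add: Z_def)
    then show "x \<in> \<Union>(Z ` {(q, q'). q \<in> \<rat> \<and> q' \<in> \<rat> \<and> q < q'})" using q q' by blast
  qed
  ultimately show ?thesis by (rule negligible_subset)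
qed

section \<open>Density of the surface at points of differentiability\<close>

text \<open>Compare the linear approximation with the exact rate -1 of \<open>F\<close> along the
  diagonal and with its antitonicity along the axes. In particular \<open>g\<close> is nonzero, so
  the surface has a normal.\<close>

lemma gradient_properties:
  assumes g: "(F has_derivative (\<lambda>h. g \<bullet> h)) (at x)"
  shows "g \<bullet> 1 = -1" "g $ i \<le> 0"
proof -
  \<comment> \<open>One small \<open>t\<close> for each \<open>e\<close> suffices, because the
    increments of \<open>F\<close> are known exactly on the diagonal and have a known sign along the
    axes. The summand 1 in \<open>norm v + 1\<close> avoids a division by 0.\<close>
  have dir: "\<exists>t>0. \<bar>F (x + t *\<^sub>R v) - F x - t * (g \<bullet> v)\<bar> \<le> e * t" if "e > 0" for e v
  proof -
    have "e / (norm v + 1) > 0" using that by (simp add: add_nonneg_pos)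
    then obtain d where d: "d > 0" "\<And>y. norm (y - x) < d \<Longrightarrow> norm (F y - F x - g \<bullet> (y - x)) \<le> e / (norm v + 1) * norm (y - x)"
      using g unfolding has_derivative_at_alt by blast
    define t where "t = d / (norm v + 1)"
    have t: "t > 0" using d(1) by (simp add: t_def add_nonneg_pos)
    have n0: "norm v + 1 > 0" by (simp add: add_nonneg_pos)
    have "norm (t *\<^sub>R v) < d"
    proof -
      have "norm (t *\<^sub>R v) = t * norm v" using t by simp
      also have "\<dots> < t * (norm v + 1)" using t by simp
      also have "\<dots> = d" using n0 by (simp add: t_def)
      finally show ?thesis .
    qed
    then have "\<bar>F (x + t *\<^sub>R v) - F x - t * (g \<bullet> v)\<bar> \<le> e / (norm v + 1) * (t * norm v)"
      using d(2)[of "x + t *\<^sub>R v"] t by simp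
    also have "\<dots> \<le> e / (norm v + 1) * (t * (norm v + 1))"
      using t \<open>e / (norm v + 1) > 0\<close> by (intro mult_left_mono) auto
    also have "\<dots> = e * t" using n0 by simp
    finally show ?thesis using t by blast
  qed
  have "\<bar>g \<bullet> 1 + 1\<bar> \<le> 0 + e" if e: "e > 0" for e
  proof -
    obtain t where t: "t > 0" "\<bar>F (x + t *\<^sub>R 1) - F x - t * (g \<bullet> 1)\<bar> \<le> e * t"
      using dir[OF e] by blast
    have "\<bar>F (x + t *\<^sub>R 1) - F x - t * (g \<bullet> 1)\<bar> = t * \<bar>g \<bullet> 1 + 1\<bar>"
    proof -
      have "F (x + t *\<^sub>R 1) - F x - t * (g \<bullet> 1) = - (t * (g \<bullet> 1 + 1))"
        by (simp add: translation algebra_simps)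
      then show ?thesis using t(1) by (simp add: abs_mult del: distrib_left)
    qed
    with t show ?thesis by (simp add: mult.commute)
  qed
  then have "\<bar>g \<bullet> 1 + 1\<bar> \<le> 0" by (rule field_le_epsilon)
  then show "g \<bullet> 1 = -1" by simp
  have "g $ i \<le> 0 + e" if e: "e > 0" for e
  proof -
    obtain t where t: "t > 0" "\<bar>F (x + t *\<^sub>R axis i 1) - F x - t * (g \<bullet> axis i 1)\<bar> \<le> e * t"
      using dir[OF e] by blast
    have "F (x + t *\<^sub>R axis i 1) \<le> F x"
      using t(1) by (intro antitone) (auto simp: less_eq_vec_def axis_def)
    with t(2) have "t * g $ i \<le> e * t" by (simp add: inner_axis abs_le_iff)
    with t(1) show ?thesis by (simp add: mult.commute)
  qed
  then show "g $ i \<le> 0" by (rule field_le_epsilon)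
qed

text \<open>Near a point of differentiability the surface \<open>\<Gamma>\<close> separates the ends of short segments in direction
  \<open>i\<close> centred on the tangent disc, so its projection covers that of the disc.\<close>

lemma slab_density:
  assumes g: "(F has_derivative (\<lambda>h. g \<bullet> h)) (at x)" and "x \<in> \<Gamma>" and i: "g $ i < 0"
    and \<eta>: "0 < \<eta>" "\<eta> < 1"
  shows "\<exists>d>0. \<forall>r. 0 < r \<longrightarrow> r < d \<longrightarrow>
    - g $ i / norm g * (unit_ball_vol (real (CARD('n) - 1)) * ((1 - \<eta>) * r) ^ (CARD('n) - 1))
     \<le> measure lebesgue (slab_over i (\<Gamma> \<inter> cball x r))"
proof -
  have "g \<noteq> 0" using i by auto
  define \<nu> where "\<nu> = - g /\<^sub>R norm g"
  have "- g $ i / norm g > 0" using \<open>g \<noteq> 0\<close> i by (intro divide_pos_pos) auto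
  then have \<nu>: "norm \<nu> = 1" "\<nu> $ i = - g $ i / norm g" "\<nu> $ i > 0"
    using \<open>g \<noteq> 0\<close> by (simp_all add: \<nu>_def divide_inverse mult.commute)
  have Fx: "F x = 0" using \<open>x \<in> \<Gamma>\<close> by (simp add: \<Gamma>_def)
  \<comment> \<open>A shift by \<open>\<eta> * r\<close> along the axis changes the linear part by
    \<open>\<eta> * r * - g $ i\<close>, twice the error \<open>e * r\<close>, so \<open>F\<close>
    has opposite signs at the two ends of the segment.\<close>
  define e where "e = - g $ i * \<eta> / 2"
  have "e > 0" using i \<eta> by (simp add: e_def mult_neg_pos)
  then obtain d where d: "d > 0" "\<And>y. norm (y - x) < d \<Longrightarrow> norm (F y - F x - g \<bullet> (y - x)) \<le> e * norm (y - x)"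
    using g unfolding has_derivative_at_alt by blast
  have "- g $ i / norm g * (unit_ball_vol (real (CARD('n) - 1)) * ((1 - \<eta>) * r) ^ (CARD('n) - 1))
     \<le> measure lebesgue (slab_over i (\<Gamma> \<inter> cball x r))" if r: "0 < r" "r < d" for r
  proof -
    \<comment> \<open>A disc of radius \<open>(1 - \<eta>) * r\<close> leaves room for shifts by
      \<open>\<eta> * r\<close> inside the ball of radius \<open>r\<close>.\<close>
    define \<rho> where "\<rho> = (1 - \<eta>) * r"
    have "\<rho> > 0" using r \<eta> by (simp add: \<rho>_def)
    have cross: "\<exists>s. x + t + s *\<^sub>R axis i 1 \<in> \<Gamma> \<inter> cball x r" if t: "t \<in> disc \<nu> \<rho>" for t
    proof -
      have gt: "g \<bullet> t = 0" using t \<open>g \<noteq> 0\<close> by (auto simp: disc_def \<nu>_def inner_commute)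
      have near: "norm (t + s *\<^sub>R axis i 1) \<le> r" if "\<bar>s\<bar> \<le> \<eta> * r" for s
      proof -
        have "norm (t + s *\<^sub>R axis i 1) \<le> norm t + \<bar>s\<bar>"
          using norm_triangle_ineq[of t "s *\<^sub>R axis i 1"] by (simp add: norm_axis_1)
        also have "\<dots> \<le> \<rho> + \<eta> * r" using t that by (auto simp: disc_def)
        also have "\<dots> = r" by (simp add: \<rho>_def algebra_simps)
        finally show ?thesis .
      qed
      have approx: "\<bar>F (x + t + s *\<^sub>R axis i 1) - s * g $ i\<bar> \<le> e * r" if "\<bar>s\<bar> \<le> \<eta> * r" for s
      proof -
        let ?y = "x + t + s *\<^sub>R axis i 1"
        have y: "?y - x = t + s *\<^sub>R axis i 1" by simp
        have "norm (F ?y - F x - g \<bullet> (?y - x)) \<le> e * norm (?y - x)"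
          using near[OF that] r unfolding y[symmetric] by (intro d(2)) simp
        also have "\<dots> \<le> e * r"
          using near[OF that] \<open>e > 0\<close> unfolding y by (intro mult_left_mono) auto
        finally show ?thesis
          unfolding y by (simp add: Fx inner_add_right gt inner_axis)
      qed
      have "e * r < \<eta> * r * - g $ i" using r i \<eta> by (simp add: e_def mult_pos_neg)
      moreover have "\<eta> * r > 0" using r \<eta> by simp
      ultimately have "F (x + t + (\<eta> * r) *\<^sub>R axis i 1) \<le> 0" "0 \<le> F (x + t + (- (\<eta> * r)) *\<^sub>R axis i 1)"
        using approx[of "\<eta> * r"] approx[of "- (\<eta> * r)"] by (auto simp: abs_le_iff)
      moreover have "continuous_on {- (\<eta> * r)..\<eta> * r} (\<lambda>s. F (x + t + s *\<^sub>R axis i 1))"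
        by (intro continuous_on_compose2[OF continuous[of UNIV]] continuous_intros) auto
      ultimately have "\<exists>s\<ge>- (\<eta> * r). s \<le> \<eta> * r \<and> F (x + t + s *\<^sub>R axis i 1) = 0"
        using \<open>\<eta> * r > 0\<close> by (intro IVT2') auto
      then obtain s where s: "- (\<eta> * r) \<le> s" "s \<le> \<eta> * r" "F (x + t + s *\<^sub>R axis i 1) = 0"
        by blast
      moreover have "dist x (x + t + s *\<^sub>R axis i 1) \<le> r"
        using near[of s] s norm_minus_cancel[of "t + s *\<^sub>R axis i 1"] by (simp add: dist_norm del: norm_minus_cancel)
      ultimately show ?thesis by (auto simp: \<Gamma>_def)
    qed
    \<comment> \<open>Removing the \<open>i\<close>-th coordinate of \<open>x\<close> keeps the
      translated slab between heights 0 and 1.\<close>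
    define c where "c = x - x $ i *\<^sub>R axis i 1"
    have "(+) c ` slab_over i (disc \<nu> \<rho>) \<subseteq> slab_over i (\<Gamma> \<inter> cball x r)"
    proof
      fix z assume "z \<in> (+) c ` slab_over i (disc \<nu> \<rho>)"
      then obtain w where w: "w \<in> slab_over i (disc \<nu> \<rho>)" "z = c + w" by blast
      obtain t where t: "t \<in> disc \<nu> \<rho>" "\<And>j. j \<noteq> i \<Longrightarrow> t $ j = w $ j" and wi: "0 \<le> w $ i" "w $ i \<le> 1"
        using w(1) unfolding slab_over_def by blast
      obtain s where s: "x + t + s *\<^sub>R axis i 1 \<in> \<Gamma> \<inter> cball x r" using cross[OF t(1)] by blast
      have "z $ i = w $ i" by (simp add: w(2) c_def)
      moreover have "(x + t + s *\<^sub>R axis i 1) $ j = z $ j" if "j \<noteq> i" for j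
        using that t(2)[OF that] by (simp add: w(2) c_def axis_def)
      ultimately show "z \<in> slab_over i (\<Gamma> \<inter> cball x r)"
        unfolding slab_over_def mem_Collect_eq using wi s
        by (intro conjI bexI[of _ "x + t + s *\<^sub>R axis i 1"]) auto
    qed
    moreover have "slab_over i (disc \<nu> \<rho>) \<in> lmeasurable"
    proof -
      have "compact (disc \<nu> \<rho>)"
        unfolding compact_eq_bounded_closed disc_def
        by (intro conjI closed_Collect_conj closed_Collect_le closed_Collect_eq continuous_intros)
           (auto simp: bounded_iff)
      then show ?thesis by (intro lmeasurable_compact compact_slab_over)
    qed
    moreover have "slab_over i (\<Gamma> \<inter> cball x r) \<in> lmeasurable"
      by (intro lmeasurable_compact compact_slab_over closed_Int_compact closed_\<Gamma> compact_cball)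
    ultimately have "measure lebesgue ((+) c ` slab_over i (disc \<nu> \<rho>)) \<le> measure lebesgue (slab_over i (\<Gamma> \<inter> cball x r))"
      by (intro measure_mono_fmeasurable) (auto simp: measurable_translation fmeasurableD)
    then show ?thesis
      using measure_slab_over_disc[OF \<nu>(1) \<open>\<rho> > 0\<close> \<nu>(3)] \<nu>(2) by (simp add: measure_translation \<rho>_def)
  qed
  with d(1) show ?thesis by blast
qed

text \<open>The entries \<open>- g $ i / norm g\<close> of the unit normal lie between 0 and 1, so
  their sum is at least the sum of their squares, which is 1. Hence the bounds for the single
  projections add up to at least the volume of the disc of radius
  \<open>(1 - \<eta>) * r\<close>.\<close>

lemma ball_density:
  assumes "F differentiable at x" "x \<in> \<Gamma>" and \<eta>: "0 < \<eta>" "\<eta> < 1"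
  shows "\<exists>d>0. \<forall>r. 0 < r \<longrightarrow> r < d \<longrightarrow>
    (1 - \<eta>) ^ (CARD('n) - 1) * (unit_ball_vol (real (CARD('n) - 1)) * r ^ (CARD('n) - 1))
     \<le> (\<Sum>i\<in>UNIV. measure lebesgue (slab_over i (\<Gamma> \<inter> cball x r)))"
proof -
  obtain D where D: "(F has_derivative D) (at x)" using assms by (auto simp: differentiable_def)
  define g where "g = adjoint D 1"
  have "D = (\<lambda>h. g \<bullet> h)"
    using adjoint_works[OF has_derivative_linear[OF D], of _ 1] by (auto simp: g_def inner_commute)
  with D have g: "(F has_derivative (\<lambda>h. g \<bullet> h)) (at x)" by simp
  note grad = gradient_properties[OF g]
  let ?v = "\<lambda>r. unit_ball_vol (real (CARD('n) - 1)) * ((1 - \<eta>) * r) ^ (CARD('n) - 1)"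
  \<comment> \<open>An entry \<open>g $ i = 0\<close> means that the tangent disc projects to a null
    set; the bound is then trivial.\<close>
  have "\<exists>d>0. \<forall>r. 0 < r \<longrightarrow> r < d \<longrightarrow> - g $ i / norm g * ?v r \<le> measure lebesgue (slab_over i (\<Gamma> \<inter> cball x r))" for i
  proof (cases "g $ i = 0")
    case True
    then show ?thesis by (auto intro!: exI[of _ 1])
  next
    case False
    then show ?thesis using grad(2)[of i] by (intro slab_density[OF g \<open>x \<in> \<Gamma>\<close> _ \<eta>]) simp
  qed
  then obtain d where d: "\<And>i. d i > 0" "\<And>i r. 0 < r \<Longrightarrow> r < d i \<Longrightarrow>
      - g $ i / norm g * ?v r \<le> measure lebesgue (slab_over i (\<Gamma> \<inter> cball x r))"
    by metis
  have "g \<noteq> 0" using grad(1) by auto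
  have one: "1 \<le> (\<Sum>i\<in>UNIV. - g $ i / norm g)"
  proof -
    have "norm g ^ 2 = (\<Sum>i\<in>UNIV. (- g $ i) * (- g $ i))"
      by (simp add: power2_norm_eq_inner inner_vec_def)
    also have "\<dots> \<le> (\<Sum>i\<in>UNIV. norm g * (- g $ i))"
    proof (intro sum_mono mult_right_mono)
      show "- g $ i \<le> norm g" for i using component_le_norm_cart[of g i] by simp
      show "0 \<le> - g $ i" for i using grad(2) by simp
    qed
    also have "\<dots> = norm g * (\<Sum>i\<in>UNIV. - g $ i)" by (simp add: sum_distrib_left)
    finally have "norm g \<le> (\<Sum>i\<in>UNIV. - g $ i)" using \<open>g \<noteq> 0\<close> by (simp add: power2_eq_square)
    moreover have "(\<Sum>i\<in>UNIV. - g $ i / norm g) = (\<Sum>i\<in>UNIV. - g $ i) / norm g"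
      by (simp add: sum_divide_distrib)
    ultimately show ?thesis using \<open>g \<noteq> 0\<close> by simp
  qed
  show ?thesis
  proof (intro exI[of _ "Min (range d)"] conjI allI impI)
    show "0 < Min (range d)" using d(1) by simp
    fix r assume r: "0 < r" "r < Min (range d)"
    then have "r < d i" for i by simp
    have "?v r \<ge> 0" using r \<eta> by simp
    then have "1 * ?v r \<le> (\<Sum>i\<in>UNIV. - g $ i / norm g) * ?v r" using one by (intro mult_right_mono)
    also have "\<dots> = (\<Sum>i\<in>UNIV. - g $ i / norm g * ?v r)" by (simp add: sum_distrib_right)
    also have "\<dots> \<le> (\<Sum>i\<in>UNIV. measure lebesgue (slab_over i (\<Gamma> \<inter> cball x r)))"
      using d(2) r \<open>\<And>i. r < d i\<close> by (intro sum_mono) auto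
    finally show "(1 - \<eta>) ^ (CARD('n) - 1) * (unit_ball_vol (real (CARD('n) - 1)) * r ^ (CARD('n) - 1))
      \<le> (\<Sum>i\<in>UNIV. measure lebesgue (slab_over i (\<Gamma> \<inter> cball x r)))"
      by (simp add: power_mult_distrib mult_ac)
  qed
qed

section \<open>Measure of the surface in the cube\<close>

text \<open>Balls of radius below \<open>\<eta>\<close> centred in the cube have their slabs in the
  cube enlarged by \<open>\<eta>\<close> on every side, and slabs of disjoint balls overlap in null
  sets. So each axis contributes at most \<open>(1 + 2 * \<eta>) ^ CARD('n)\<close>, and the density
  bound costs a division by a power of \<open>1 - \<eta>\<close>. Both corrections vanish as
  \<open>\<eta>\<close> tends to 0.\<close>

lemma hausdorff_measure_differentiable_part:
  "hausdorff_measure (real (CARD('n) - 1)) {x \<in> \<Gamma>. F differentiable at x \<and> (\<forall>i. 0 \<le> x $ i \<and> x $ i \<le> 1)}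
     \<le> of_nat CARD('n)" (is "hausdorff_measure (real ?m) ?S \<le> _")
proof (rule hausdorff_measure_leI)
  fix \<delta> :: real assume "\<delta> > 0"
  let ?M = "\<lambda>\<eta>::real. CARD('n) * (1 + 2 * \<eta>) ^ CARD('n) / (1 - \<eta>) ^ ?m"
  let ?slab = "\<lambda>i p. slab_over i (\<Gamma> \<inter> cball (fst p) (snd p))"
  have bound: "hausdorff_premeasure (real ?m) \<delta> ?S \<le> ennreal (?M \<eta>)" if \<eta>: "0 < \<eta>" "\<eta> < 1" "\<eta> \<le> \<delta>" for \<eta>
  proof -
    have "hausdorff_premeasure (real ?m) \<eta> ?S \<le> ennreal (?M \<eta>)"
    proof (rule hausdorff_premeasure_Vitali[where Q = "\<lambda>x r.
        (1 - \<eta>) ^ ?m * (unit_ball_vol (real ?m) * r ^ ?m) \<le> (\<Sum>i\<in>UNIV. measure lebesgue (slab_over i (\<Gamma> \<inter> cball x r)))"])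
      fix x and d :: real assume x: "x \<in> ?S" and "d > 0"
      obtain d' where d': "d' > 0" "\<And>r. 0 < r \<Longrightarrow> r < d' \<Longrightarrow>
          (1 - \<eta>) ^ ?m * (unit_ball_vol (real ?m) * r ^ ?m) \<le> (\<Sum>i\<in>UNIV. measure lebesgue (slab_over i (\<Gamma> \<inter> cball x r)))"
        using ball_density[of x \<eta>] x \<eta> by blast
      show "\<exists>r. 0 < r \<and> r < d \<and>
          (1 - \<eta>) ^ ?m * (unit_ball_vol (real ?m) * r ^ ?m) \<le> (\<Sum>i\<in>UNIV. measure lebesgue (slab_over i (\<Gamma> \<inter> cball x r)))"
        using d' \<open>d > 0\<close> by (intro exI[of _ "min d d' / 2"]) (auto simp: min_def)
    next
      fix J :: "((real, 'n) vec \<times> real) set"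
      assume "finite J" and J: "\<And>x r. (x, r) \<in> J \<Longrightarrow> x \<in> ?S \<and> 0 < r \<and> r < \<eta> \<and>
          (1 - \<eta>) ^ ?m * (unit_ball_vol (real ?m) * r ^ ?m) \<le> (\<Sum>i\<in>UNIV. measure lebesgue (slab_over i (\<Gamma> \<inter> cball x r)))"
        and disj: "pairwise (\<lambda>i j. disjnt (cball (fst i) (snd i)) (cball (fst j) (snd j))) J"
      have lm: "?slab i p \<in> lmeasurable" for i p
        by (intro lmeasurable_compact compact_slab_over closed_Int_compact closed_\<Gamma> compact_cball)
      have slab: "(\<Sum>p\<in>J. measure lebesgue (?slab i p)) \<le> (1 + 2 * \<eta>) ^ CARD('n)" for i
      proof -
        have "(\<Sum>p\<in>J. measure lebesgue (?slab i p)) = measure lebesgue (\<Union>p\<in>J. ?slab i p)"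
        proof (rule measure_negligible_finite_Union_image[symmetric, OF \<open>finite J\<close> lm])
          show "pairwise (\<lambda>p q. negligible (?slab i p \<inter> ?slab i q)) J"
            using disj by (intro pairwise_mono[OF disj _ order_refl] negligible_slab_overlap) (auto simp: disjnt_def)
        qed
        also have "\<dots> \<le> measure lebesgue (cbox (\<chi> j. - \<eta>) (\<chi> j. 1 + \<eta>) :: (real, 'n) vec set)"
        proof (rule measure_mono_fmeasurable)
          show "(\<Union>p\<in>J. ?slab i p) \<subseteq> cbox (\<chi> j. - \<eta>) (\<chi> j. 1 + \<eta>)"
          proof clarify
            fix x r z assume xr: "(x, r) \<in> J" and z: "z \<in> ?slab i (x, r)"
            obtain y where y: "y \<in> cball x r" "\<And>j. j \<noteq> i \<Longrightarrow> y $ j = z $ j" and zi: "0 \<le> z $ i" "z $ i \<le> 1"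
              using z by (auto simp: slab_over_def)
            have "- \<eta> \<le> z $ j \<and> z $ j \<le> 1 + \<eta>" for j
            proof (cases "j = i")
              case True
              then show ?thesis using zi \<eta> by simp
            next
              case False
              have "\<bar>(y - x) $ j\<bar> \<le> norm (y - x)" by (rule component_le_norm_cart)
              also have "\<dots> \<le> \<eta>" using y(1) J[OF xr] by (simp add: dist_norm norm_minus_commute)
              finally have "\<bar>z $ j - x $ j\<bar> \<le> \<eta>" using y(2)[OF False] by simp
              moreover have "0 \<le> x $ j" "x $ j \<le> 1" using J[OF xr] by auto
              ultimately show ?thesis by linarith
            qed
            then show "z \<in> cbox (\<chi> j. - \<eta>) (\<chi> j. 1 + \<eta>)" by (simp add: mem_box_cart)
          qed
          show "(\<Union>p\<in>J. ?slab i p) \<in> sets lebesgue"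
            using lm \<open>finite J\<close> by (auto intro!: sets.finite_UN fmeasurableD)
        qed simp
        also have "\<dots> = (1 + 2 * \<eta>) ^ CARD('n)"
        proof -
          have "measure lborel (cbox (\<chi> j. - \<eta>) (\<chi> j. 1 + \<eta>) :: (real, 'n) vec set) = (\<Prod>j\<in>(UNIV::'n set). 1 + 2 * \<eta>)"
            using \<eta> by (subst content_cbox_cart) (auto simp: interval_ne_empty_cart add.commute)
          then show ?thesis by simp
        qed
        finally show ?thesis .
      qed
      have "(1 - \<eta>) ^ ?m * (\<Sum>p\<in>J. unit_ball_vol (real ?m) * snd p ^ ?m) =
          (\<Sum>p\<in>J. (1 - \<eta>) ^ ?m * (unit_ball_vol (real ?m) * snd p ^ ?m))"
        by (rule sum_distrib_left)
      also have "\<dots> \<le> (\<Sum>p\<in>J. \<Sum>i\<in>UNIV. measure lebesgue (?slab i p))"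
      proof (rule sum_mono)
        fix p assume "p \<in> J"
        then show "(1 - \<eta>) ^ ?m * (unit_ball_vol (real ?m) * snd p ^ ?m) \<le> (\<Sum>i\<in>UNIV. measure lebesgue (?slab i p))"
          using J[of "fst p" "snd p"] by simp
      qed
      also have "\<dots> = (\<Sum>i\<in>UNIV. \<Sum>p\<in>J. measure lebesgue (?slab i p))"
        by (rule sum.swap)
      also have "\<dots> \<le> (\<Sum>i\<in>(UNIV::'n set). (1 + 2 * \<eta>) ^ CARD('n))"
        by (intro sum_mono slab)
      finally show "(\<Sum>p\<in>J. unit_ball_vol (real ?m) * snd p ^ ?m) \<le> ?M \<eta>"
        using \<eta> by (simp add: pos_le_divide_eq mult.commute)
    qed (use \<eta> in auto)
    \<comment> \<open>A finer scale only raises the premeasure, so \<open>\<eta>\<close> may tend to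
      0 while \<open>\<delta>\<close> stays fixed.\<close>
    moreover have "hausdorff_premeasure (real ?m) \<delta> ?S \<le> hausdorff_premeasure (real ?m) \<eta> ?S"
      using \<eta> by (intro hausdorff_premeasure_antimono)
    ultimately show ?thesis by (rule order_trans[rotated])
  qed
  have "((\<lambda>\<eta>. ennreal (?M \<eta>)) \<longlongrightarrow> ennreal (?M 0)) (at_right 0)"
    by (intro tendsto_intros) auto
  moreover have "\<forall>\<^sub>F \<eta> in at_right 0. hausdorff_premeasure (real ?m) \<delta> ?S \<le> ennreal (?M \<eta>)"
    unfolding eventually_at_right_field
    using bound \<open>\<delta> > 0\<close> by (intro exI[of _ "min \<delta> 1"]) auto
  ultimately have "hausdorff_premeasure (real ?m) \<delta> ?S \<le> ennreal (?M 0)"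
    by (intro tendsto_lowerbound) auto
  then show "hausdorff_premeasure (real ?m) \<delta> ?S \<le> of_nat CARD('n)"
    by (simp add: ennreal_of_nat_eq_real_of_nat)
qed

text \<open>The null set \<open>N\<close> is invariant under translation along the diagonal \<open>\<nu>\<close>, so an open set of small
  volume around it contains cylinders of height \<open>1\<close> over small discs at the points of \<open>\<Gamma> \<inter> N\<close>. As
  \<open>\<Gamma>\<close> is a Lipschitz graph over the hyperplane orthogonal to \<open>\<nu>\<close>, cylinders over points that are far
  apart are disjoint.\<close>

lemma hausdorff_measure_nondifferentiable_part:
  "hausdorff_measure (real (CARD('n) - 1)) {x \<in> \<Gamma>. \<not> F differentiable at x} = 0" (is "hausdorff_measure (real ?m) ?S = 0")
proof -
  define N where "N = {x. \<not> F differentiable at x}"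
  have "negligible N" unfolding N_def by (rule Rademacher_real[OF Lipschitz])
  define \<nu> :: "(real, 'n) vec" where "\<nu> = 1 /\<^sub>R norm (1 :: (real, 'n) vec)"
  have n1: "norm (1 :: (real, 'n) vec) > 0" by simp
  have \<nu>: "norm \<nu> = 1" using n1 by (simp add: \<nu>_def)
  have F\<nu>: "F (x + s *\<^sub>R \<nu>) = F x - s / norm (1 :: (real, 'n) vec)" for x s
    using translation[of x "s / norm (1 :: (real, 'n) vec)"] by (simp add: \<nu>_def divide_inverse)
  have N_line: "x + s *\<^sub>R \<nu> \<in> N" if "x \<in> N" for x s
    using that differentiable_translate[of x "s / norm (1 :: (real, 'n) vec)"] by (auto simp: N_def \<nu>_def divide_inverse)
  \<comment> \<open>If the cylinders over \<open>x\<close> and \<open>y\<close> meet, these points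
    differ by at most \<open>(r + s) / K\<close> across the diagonal and, by the Lipschitz bound, by
    at most \<open>norm 1\<close> times as much along it. This \<open>K\<close> makes their distance
    at most \<open>(r + s) / 2\<close>, hence at most the larger radius.\<close>
  define K where "K = 2 * (norm (1 :: (real, 'n) vec) + 1)"
  have "K > 0" unfolding K_def by (intro mult_pos_pos add_nonneg_pos norm_ge_zero) simp_all
  define T where "T x r = (+) x ` cylinder \<nu> (r / K)" for x r
  have T_volume: "measure lebesgue (T x r) = unit_ball_vol (real ?m) * (r / K) ^ ?m" "T x r \<in> lmeasurable" if "r > 0" for x r
    using measure_cylinder[OF \<nu>, of "r / K"] that \<open>K > 0\<close> compact_cylinder[OF \<nu>]
    by (simp_all add: T_def measure_translation measurable_translation lmeasurable_compact)
  have T_disjoint: "T x r \<inter> T y s = {}"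
    if xy: "x \<in> \<Gamma>" "y \<in> \<Gamma>" and rs: "r > 0" "s > 0" and disj: "disjnt (cball x r) (cball y s)" for x y r s
  proof (rule ccontr)
    assume "T x r \<inter> T y s \<noteq> {}"
    then obtain p q where p: "p \<in> cylinder \<nu> (r / K)" and q: "q \<in> cylinder \<nu> (s / K)" and eq: "x + p = y + q"
      unfolding T_def by blast
    define w where "w = (q - (q \<bullet> \<nu>) *\<^sub>R \<nu>) - (p - (p \<bullet> \<nu>) *\<^sub>R \<nu>)"
    define a where "a = q \<bullet> \<nu> - p \<bullet> \<nu>"
    have x: "x = (y + w) + a *\<^sub>R \<nu>"
    proof -
      have "y + w + a *\<^sub>R \<nu> = (y + q) - p"
        by (simp add: w_def a_def scaleR_diff_left)
      then show ?thesis by (simp flip: eq)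
    qed
    have "norm w \<le> norm (q - (q \<bullet> \<nu>) *\<^sub>R \<nu>) + norm (p - (p \<bullet> \<nu>) *\<^sub>R \<nu>)"
      unfolding w_def by (rule norm_triangle_ineq4)
    also have "\<dots> \<le> s / K + r / K"
      using p q unfolding cylinder_def by (intro add_mono) auto
    finally have "norm w \<le> s / K + r / K" .
    then have w: "norm w \<le> (r + s) / K" by (simp add: add_divide_distrib)
    have "F x = F (y + w) - a / norm (1 :: (real, 'n) vec)" unfolding x by (rule F\<nu>)
    then have "\<bar>a\<bar> / norm (1 :: (real, 'n) vec) = \<bar>F (y + w) - F y\<bar>"
      using xy n1 by (simp add: \<Gamma>_def abs_divide)
    also have "\<dots> \<le> norm w" using Lipschitz_le[of "y + w" y] by simp
    finally have a: "\<bar>a\<bar> \<le> norm (1 :: (real, 'n) vec) * norm w"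
      using n1 by (simp add: pos_divide_le_eq mult.commute)
    have "dist x y = norm (w + a *\<^sub>R \<nu>)" by (simp add: x dist_norm)
    also have "\<dots> \<le> norm w + \<bar>a\<bar>"
      using norm_triangle_ineq[of w "a *\<^sub>R \<nu>"] \<nu> by simp
    also have "\<dots> \<le> (K / 2) * norm w" using a by (simp add: K_def algebra_simps)
    also have "\<dots> \<le> (K / 2) * ((r + s) / K)" using w \<open>K > 0\<close> by (intro mult_left_mono) auto
    also have "\<dots> = (r + s) / 2" using \<open>K > 0\<close> by simp
    also have "\<dots> \<le> max r s" by simp
    finally have "dist x y \<le> r \<or> dist x y \<le> s" by linarith
    then have "y \<in> cball x r \<and> y \<in> cball y s \<or> x \<in> cball x r \<and> x \<in> cball y s"
      using rs by (auto simp: dist_commute)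
    with disj show False unfolding disjnt_def by blast
  qed
  have "hausdorff_measure (real ?m) ?S \<le> 0"
  proof (rule hausdorff_measure_leI)
    fix \<delta> :: real assume "\<delta> > 0"
    show "hausdorff_premeasure (real ?m) \<delta> ?S \<le> 0"
    proof (rule ennreal_le_epsilon)
      fix e :: real assume "e > 0"
      \<comment> \<open>A cylinder of radius \<open>r / K\<close> has \<open>1 / K ^ ?m\<close>
        times the weight of the ball of radius \<open>r\<close>.\<close>
      define e' where "e' = e / K ^ ?m"
      have "e' > 0" using \<open>e > 0\<close> \<open>K > 0\<close> by (simp add: e'_def)
      have "N \<in> sets lebesgue" using \<open>negligible N\<close> by (rule negligible_imp_sets)
      then obtain U where U: "open U" "N \<subseteq> U" "U - N \<in> lmeasurable" "emeasure lebesgue (U - N) < ennreal e'"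
        using sets_lebesgue_outer_open[OF _ \<open>e' > 0\<close>] by metis
      have "U = (U - N) \<union> N" using U(2) by blast
      then have "U \<in> lmeasurable" "measure lebesgue U = measure lebesgue (U - N)"
        using U(3) \<open>negligible N\<close>
        by (metis fmeasurable.Un negligible_imp_measurable, metis measure_Un_null_set negligible_iff_null_sets fmeasurableD)
      moreover have "measure lebesgue (U - N) \<le> e'"
        using U(3,4) \<open>e' > 0\<close> by (simp add: emeasure_eq_measure2 fmeasurableD2 ennreal_less_iff)
      ultimately have U': "U \<in> lmeasurable" "measure lebesgue U \<le> e'" by auto
      have "hausdorff_premeasure (real ?m) \<delta> ?S \<le> ennreal e"
      proof (rule hausdorff_premeasure_Vitali[where Q = "\<lambda>x r. T x r \<subseteq> U"])
        fix x and d :: real assume x: "x \<in> ?S" and "d > 0"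
        let ?L = "(\<lambda>s. x + s *\<^sub>R \<nu>) ` {0..1}"
        \<comment> \<open>The diagonal segment of length 1 from \<open>x\<close> stays in
          \<open>N\<close> and hence in \<open>U\<close>; by compactness a whole neighbourhood of
          it, and so a thin cylinder, lies in \<open>U\<close>.\<close>
        have "compact ?L" by (intro compact_continuous_image continuous_intros) auto
        moreover have "?L \<subseteq> U" using x N_line U(2) by (auto simp: N_def)
        ultimately obtain \<epsilon> where \<epsilon>: "\<epsilon> > 0" "(\<Union>y\<in>?L. ball y \<epsilon>) \<subseteq> U"
          using \<open>open U\<close> compact_subset_open_imp_ball_epsilon_subset by metis
        define r where "r = min (d / 2) (K * \<epsilon> / 2)"
        have r: "0 < r" "r < d" "r / K < \<epsilon>"
          using \<open>d > 0\<close> \<open>\<epsilon> > 0\<close> \<open>K > 0\<close> by (auto simp: r_def min_def field_simps)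
        have "T x r \<subseteq> U"
        proof
          fix z assume "z \<in> T x r"
          then obtain p where p: "p \<in> cylinder \<nu> (r / K)" "z = x + p" by (auto simp: T_def)
          then have "x + (p \<bullet> \<nu>) *\<^sub>R \<nu> \<in> ?L" by (auto simp: cylinder_def)
          moreover have "z \<in> ball (x + (p \<bullet> \<nu>) *\<^sub>R \<nu>) \<epsilon>"
            using p r(3) by (simp add: cylinder_def dist_norm norm_minus_commute)
          ultimately show "z \<in> U" using \<epsilon>(2) by blast
        qed
        with r show "\<exists>r. 0 < r \<and> r < d \<and> T x r \<subseteq> U" by blast
      next
        fix J :: "((real, 'n) vec \<times> real) set"
        assume "finite J" and J: "\<And>x r. (x, r) \<in> J \<Longrightarrow> x \<in> ?S \<and> 0 < r \<and> r < \<delta> \<and> T x r \<subseteq> U"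
          and disj: "pairwise (\<lambda>i j. disjnt (cball (fst i) (snd i)) (cball (fst j) (snd j))) J"
        have J': "fst p \<in> \<Gamma>" "snd p > 0" "T (fst p) (snd p) \<subseteq> U" if "p \<in> J" for p
          using J[of "fst p" "snd p"] that by auto
        have "(\<Sum>p\<in>J. unit_ball_vol (real ?m) * snd p ^ ?m) = (\<Sum>p\<in>J. K ^ ?m * measure lebesgue (T (fst p) (snd p)))"
          using J' \<open>K > 0\<close> by (intro sum.cong) (auto simp: T_volume power_divide)
        also have "\<dots> = K ^ ?m * (\<Sum>p\<in>J. measure lebesgue (T (fst p) (snd p)))"
          by (simp add: sum_distrib_left)
        also have "(\<Sum>p\<in>J. measure lebesgue (T (fst p) (snd p))) = measure lebesgue (\<Union>p\<in>J. T (fst p) (snd p))"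
        proof (rule measure_negligible_finite_Union_image[symmetric, OF \<open>finite J\<close>])
          show "T (fst p) (snd p) \<in> lmeasurable" if "p \<in> J" for p using T_volume(2) J'[OF that] by blast
          show "pairwise (\<lambda>p q. negligible (T (fst p) (snd p) \<inter> T (fst q) (snd q))) J"
          proof (rule pairwiseI)
            fix p q assume "p \<in> J" "q \<in> J" "p \<noteq> q"
            then have "T (fst p) (snd p) \<inter> T (fst q) (snd q) = {}"
              using J' disj by (intro T_disjoint) (auto simp: pairwise_def)
            then show "negligible (T (fst p) (snd p) \<inter> T (fst q) (snd q))" by simp
          qed
        qed
        also have "\<dots> \<le> measure lebesgue U"
          using J' T_volume(2) U'(1) \<open>finite J\<close>
          by (intro measure_mono_fmeasurable sets.finite_UN UN_least) (auto intro: fmeasurableD)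
        also have "\<dots> \<le> e'" by (rule U')
        finally show "(\<Sum>p\<in>J. unit_ball_vol (real ?m) * snd p ^ ?m) \<le> e"
          using \<open>K > 0\<close> by (simp add: e'_def mult_left_mono)
      qed (use \<open>\<delta> > 0\<close> \<open>e > 0\<close> in auto)
      then show "hausdorff_premeasure (real ?m) \<delta> ?S \<le> 0 + ennreal e" by simp
    qed
  qed
  then show ?thesis by simp
qed

lemma hausdorff_measure_level_set:
  "hausdorff_measure (real (CARD('n) - 1)) (\<Gamma> \<inter> {x. \<forall>i. 0 \<le> x $ i \<and> x $ i \<le> 1}) \<le> of_nat CARD('n)"
    (is "hausdorff_measure (real ?m) ?A \<le> _")
proof -
  let ?D = "{x \<in> \<Gamma>. F differentiable at x \<and> (\<forall>i. 0 \<le> x $ i \<and> x $ i \<le> 1)}"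
  let ?N = "{x \<in> \<Gamma>. \<not> F differentiable at x}"
  have "hausdorff_measure (real ?m) ?A \<le> hausdorff_measure (real ?m) (?D \<union> ?N)"
    by (intro hausdorff_measure_mono) auto
  also have "\<dots> \<le> hausdorff_measure (real ?m) ?D + hausdorff_measure (real ?m) ?N"
    by (rule hausdorff_measure_Un)
  also have "\<dots> \<le> of_nat CARD('n)"
    using hausdorff_measure_differentiable_part hausdorff_measure_nondifferentiable_part by simp
  finally show ?thesis .
qed

end

section \<open>Antichains in the cube\<close>

text \<open>Sort the points by the largest size of a chain that ends in them.\<close>

lemma k_antichain_decomposition:
  fixes A :: "'a::order set"
  assumes "k_antichain k S A"
  obtains L where "A = (\<Union>j\<in>{1..k}. L j)" "\<And>j x y. x \<in> L j \<Longrightarrow> y \<in> L j \<Longrightarrow> x \<le> y \<Longrightarrow> x = y"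
proof -
  \<comment> \<open>The chains are taken inside \<open>A\<close>, so the bound \<open>k\<close> on
    intersections with \<open>A\<close> limits their own size.\<close>
  define Ch where "Ch x = {C. C \<subseteq> A \<and> Complete_Partial_Order.chain (\<le>) C \<and> x \<in> C \<and> (\<forall>c\<in>C. c \<le> x)}" for x
  have Ch: "finite C \<and> card C \<le> k" if "C \<in> Ch x" for C x
  proof -
    have "C \<subseteq> S" "Complete_Partial_Order.chain (\<le>) C" "A \<inter> C = C"
      using that assms by (auto simp: Ch_def k_antichain_def)
    moreover have "C \<subseteq> S \<and> Complete_Partial_Order.chain (\<le>) C \<longrightarrow> finite (A \<inter> C) \<and> card (A \<inter> C) \<le> k"
      using assms unfolding k_antichain_def by blast
    ultimately show ?thesis by simp
  qed
  define h where "h x = Max (card ` Ch x)" for x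
  have fin: "finite (card ` Ch x)" for x
  proof (rule finite_subset)
    show "card ` Ch x \<subseteq> {..k}" using Ch[of _ x] by (intro image_subsetI) simp
  qed simp
  have single: "{x} \<in> Ch x" if "x \<in> A" for x
    using that by (auto simp: Ch_def chain_def)
  have h_le: "1 \<le> h x \<and> h x \<le> k" if "x \<in> A" for x
  proof
    have "card {x} \<le> h x" unfolding h_def by (intro Max_ge fin imageI single[OF that])
    then show "1 \<le> h x" by simp
    show "h x \<le> k" unfolding h_def using fin[of x] single[OF that] Ch[of _ x] by (subst Max_le_iff) auto
  qed
  have h_less: "h x < h y" if "x \<in> A" "y \<in> A" "x \<le> y" "x \<noteq> y" for x y
  proof -
    have "h x \<in> card ` Ch x" unfolding h_def using fin single[OF \<open>x \<in> A\<close>] by (intro Max_in) auto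
    then obtain C where C: "C \<in> Ch x" "card C = h x" by auto
    have "y \<notin> C" using C(1) that by (auto simp: Ch_def)
    have "insert y C \<in> Ch y"
    proof -
      have "c \<le> y" if "c \<in> C" for c using that C(1) \<open>x \<le> y\<close> unfolding Ch_def by (blast intro: order_trans)
      then show ?thesis using C(1) \<open>y \<in> A\<close> unfolding Ch_def chain_def by blast
    qed
    then have "card (insert y C) \<le> h y" unfolding h_def by (intro Max_ge fin imageI)
    then show ?thesis using C Ch[OF C(1)] \<open>y \<notin> C\<close> by simp
  qed
  show thesis
  proof
    show "A = (\<Union>j\<in>{1..k}. {x \<in> A. h x = j})" using h_le by auto
    show "x = y" if "x \<in> {x \<in> A. h x = j}" "y \<in> {x \<in> A. h x = j}" "x \<le> y" for j x y
      using that h_less by fastforce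
  qed
qed

abbreviation unit_cube :: "(real ^ 'n) set" where
  "unit_cube \<equiv> {x. \<forall>i. 0 \<le> x $ i \<and> x $ i \<le> 1}"

text \<open>At a point of \<open>A\<close> the supremum is at least 0, witnessed by the point
  itself. A positive value would put it strictly below another point of \<open>A\<close> in every
  coordinate. Nonemptiness gives the supremum a meaning.\<close>

lemma antichain_in_level_set:
  fixes A :: "(real ^ 'n::{finite,wellorder}) set"
  assumes A: "A \<noteq> {}" "A \<subseteq> unit_cube" and anti: "\<And>x y. x \<in> A \<Longrightarrow> y \<in> A \<Longrightarrow> x \<le> y \<Longrightarrow> x = y"
  obtains F where "antitone_translation F" "A \<subseteq> antitone_translation.\<Gamma> F"
proof -
  \<comment> \<open>\<open>m a x\<close> is the largest \<open>t\<close> such that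
    \<open>x + t *\<^sub>R 1\<close> still lies below \<open>a\<close>.\<close>
  define m where "m a x = Min (range (\<lambda>i. a $ i - x $ i))" for a x :: "(real, 'n) vec"
  have m_ge: "c \<le> m a x \<longleftrightarrow> (\<forall>i. c \<le> a $ i - x $ i)" for c a x by (simp add: m_def)
  have m_le: "m a x \<le> a $ i - x $ i" for a x i by (simp add: m_def)
  define F where "F x = (SUP a\<in>A. m a x)" for x
  have bdd: "bdd_above ((\<lambda>a. m a x) ` A)" for x
  proof (rule bdd_aboveI2)
    fix a assume "a \<in> A"
    then have "a $ i \<le> 1" for i using A(2) by auto
    \<comment> \<open>Any single coordinate gives a bound independent of \<open>a\<close>;
      \<open>undefined\<close> names an arbitrary index.\<close>
    then show "m a x \<le> 1 - x $ undefined" using m_le[of a x undefined] by (meson diff_right_mono order_trans)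
  qed
  have F_ge: "m a x \<le> F x" if "a \<in> A" for a x
    unfolding F_def using that bdd by (rule cSUP_upper)
  have F_le: "F x \<le> c" if "\<And>a. a \<in> A \<Longrightarrow> m a x \<le> c" for x c
    unfolding F_def using A(1) that by (rule cSUP_least)
  have F_shift: "F (x + t *\<^sub>R 1) \<le> F x - t" for x t
  proof (rule F_le)
    fix a assume "a \<in> A"
    have "m a (x + t *\<^sub>R 1) + t \<le> m a x"
      using m_le[of a "x + t *\<^sub>R 1"] by (simp add: m_ge algebra_simps)
    then show "m a (x + t *\<^sub>R 1) \<le> F x - t" using F_ge[OF \<open>a \<in> A\<close>, of x] by simp
  qed
  interpret antitone_translation F
  proof
    show "F y \<le> F x" if "x \<le> y" for x y
    proof (rule F_le)
      fix a assume "a \<in> A"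
      have "m a y \<le> a $ i - x $ i" for i
        using m_le[of a y i] that by (simp add: less_eq_vec_def) (smt (verit))
      then have "m a y \<le> m a x" by (simp add: m_ge)
      then show "m a y \<le> F x" using F_ge[OF \<open>a \<in> A\<close>, of x] by simp
    qed
    show "F (x + t *\<^sub>R 1) = F x - t" for x t
      using F_shift[of x t] F_shift[of "x + t *\<^sub>R 1" "-t"] by simp
  qed
  have "A \<subseteq> \<Gamma>"
  proof
    fix a assume a: "a \<in> A"
    have "m a' a \<le> 0" if "a' \<in> A" for a'
    proof (rule ccontr)
      assume "\<not> m a' a \<le> 0"
      then have less: "a $ i < a' $ i" for i using m_le[of a' a i] by linarith
      then have "a \<le> a'" by (simp add: less_eq_vec_def less_imp_le)
      then have "a = a'" using anti a that by blast
      with less show False by blast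
    qed
    moreover have "0 \<le> m a a" by (simp add: m_ge)
    ultimately show "a \<in> \<Gamma>"
      using F_le[of a 0] F_ge[OF a, of a] by (simp add: \<Gamma>_def order_antisym)
  qed
  with antitone_translation_axioms show thesis by (rule that)
qed

lemma hausdorff_measure_antichain_le:
  fixes A :: "(real ^ 'n::{finite,wellorder}) set"
  assumes A: "A \<subseteq> unit_cube" and anti: "\<And>x y. x \<in> A \<Longrightarrow> y \<in> A \<Longrightarrow> x \<le> y \<Longrightarrow> x = y"
  shows "hausdorff_measure (real (CARD('n) - 1)) A \<le> of_nat CARD('n)"
proof (cases "A = {}")
  case False
  then obtain F where F: "antitone_translation F" "A \<subseteq> antitone_translation.\<Gamma> F"
    using antichain_in_level_set[OF _ A anti] by blast
  have "hausdorff_measure (real (CARD('n) - 1)) A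
      \<le> hausdorff_measure (real (CARD('n) - 1)) (antitone_translation.\<Gamma> F \<inter> unit_cube)"
    using F(2) A by (intro hausdorff_measure_mono) blast
  also have "\<dots> \<le> of_nat CARD('n)" by (rule antitone_translation.hausdorff_measure_level_set[OF F(1)])
  finally show ?thesis .
qed simp

lemma hausdorff_measure_k_antichain_le:
  fixes A :: "(real ^ 'n::{finite,wellorder}) set"
  assumes A: "k_antichain k unit_cube A"
  shows "hausdorff_measure (real (CARD('n) - 1)) A \<le> of_nat (k * CARD('n))"
proof -
  obtain L where L: "A = (\<Union>j\<in>{1..k}. L j)" "\<And>j x y. x \<in> L j \<Longrightarrow> y \<in> L j \<Longrightarrow> x \<le> y \<Longrightarrow> x = y"
    using k_antichain_decomposition[OF A] by metis
  have "A \<subseteq> unit_cube" using A by (simp add: k_antichain_def)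
  have "hausdorff_measure (real (CARD('n) - 1)) A \<le> (\<Sum>j\<in>{1..k}. hausdorff_measure (real (CARD('n) - 1)) (L j))"
    unfolding L(1) by (rule hausdorff_measure_UN) simp
  also have "\<dots> \<le> (\<Sum>j\<in>{1..k}. of_nat CARD('n))"
    using L \<open>A \<subseteq> unit_cube\<close> by (intro sum_mono hausdorff_measure_antichain_le) blast+
  also have "\<dots> = of_nat (k * CARD('n))" by simp
  finally show ?thesis .
qed

text \<open>The library states the change of variables for linear maps only for well-ordered index types, so
  the coordinates are renamed by an arbitrary well-ordered copy of the index type.\<close>

typedef (overloaded) 'n ranked = "UNIV :: 'n set" by auto

lemma bij_Rep_ranked: "bij Rep_ranked"
  by (metis Abs_ranked_inverse Rep_ranked_inject UNIV_I bijI injI surjI)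

instantiation ranked :: (finite) "{finite, wellorder}"
begin

definition "x \<le> y \<longleftrightarrow> to_nat (Rep_ranked x) \<le> to_nat (Rep_ranked y)"
definition "x < y \<longleftrightarrow> to_nat (Rep_ranked x) < to_nat (Rep_ranked y)"

instance
proof
  show "finite (UNIV :: 'a ranked set)"
  proof -
    have "bij (Rep_ranked :: 'a ranked \<Rightarrow> 'a)" by (rule bij_Rep_ranked)
    then show ?thesis by (auto dest: bij_betw_finite)
  qed
  fix P :: "'a ranked \<Rightarrow> bool" and a
  assume *: "\<And>x. (\<And>y. y < x \<Longrightarrow> P y) \<Longrightarrow> P x"
  show "P a"
  proof (induction "to_nat (Rep_ranked a)" arbitrary: a rule: less_induct)
    case less
    show ?case by (rule *) (use less in \<open>simp add: less_ranked_def\<close>)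
  qed
qed (auto simp: less_eq_ranked_def less_ranked_def Rep_ranked_inject)

end

lemma card_ranked: "CARD('n ranked) = CARD('n)"
  by (rule bij_betw_same_card[OF bij_Rep_ranked])

lemma all_Rep_ranked: "(\<forall>i. P (Rep_ranked i)) \<longleftrightarrow> (\<forall>j. P j)"
  by (metis Abs_ranked_inverse UNIV_I)

theorem theorem1p5:
  fixes A :: "(real ^ 'n) set" and k :: nat
  assumes "k \<ge> 1"
    and "k_antichain k {x. \<forall>i. 0 \<le> x $ i \<and> x $ i \<le> 1} A"
  shows "hausdorff_measure (real (CARD('n) - 1)) A \<le> of_nat (k * CARD('n))"
proof -
  define f :: "real ^ 'n \<Rightarrow> real ^ 'n ranked" where "f x = (\<chi> i. x $ Rep_ranked i)" for x
  define g :: "real ^ 'n ranked \<Rightarrow> real ^ 'n" where "g y = (\<chi> i. y $ Abs_ranked i)" for y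
  have gf: "g (f x) = x" for x by (simp add: g_def f_def vec_eq_iff Abs_ranked_inverse)
  have fg: "f (g y) = y" for y by (simp add: g_def f_def vec_eq_iff Rep_ranked_inverse)
  have dist_f: "dist (f x) (f y) = dist x y" for x y
    unfolding dist_vec_def L2_set_def
    using sum.reindex_bij_betw[OF bij_Rep_ranked, of "\<lambda>i. (dist (x $ i) (y $ i))\<^sup>2"]
    by (simp add: f_def)
  then have dist_g: "dist (g x) (g y) = dist x y" for x y by (metis fg)
  have f_le: "f x \<le> f y \<longleftrightarrow> x \<le> y" for x y
    using all_Rep_ranked[of "\<lambda>j. x $ j \<le> y $ j"] by (simp add: f_def less_eq_vec_def)
  have g_le: "g x \<le> g y \<longleftrightarrow> x \<le> y" for x y using f_le[of "g x" "g y"] by (simp add: fg)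
  have cube: "f x \<in> unit_cube \<longleftrightarrow> x \<in> unit_cube" for x
    using all_Rep_ranked[of "\<lambda>j. 0 \<le> x $ j \<and> x $ j \<le> 1"] by (simp add: f_def)
  have "k_antichain k unit_cube (f ` A)"
    unfolding k_antichain_def
  proof (intro conjI allI impI)
    show "f ` A \<subseteq> unit_cube" using assms(2) cube unfolding k_antichain_def by blast
    fix C :: "(real ^ 'n ranked) set" assume C: "C \<subseteq> unit_cube \<and> Complete_Partial_Order.chain (\<le>) C"
    have "g ` C \<subseteq> unit_cube" using C cube fg by (metis (no_types, lifting) image_subsetI subsetD)
    moreover have "Complete_Partial_Order.chain (\<le>) (g ` C)"
      using C by (auto simp: chain_def g_le)
    ultimately have "finite (A \<inter> g ` C) \<and> card (A \<inter> g ` C) \<le> k"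
      using assms(2) unfolding k_antichain_def by blast
    moreover have "f ` A \<inter> C = f ` (A \<inter> g ` C)"
    proof (intro equalityI subsetI)
      fix y assume "y \<in> f ` A \<inter> C"
      then obtain a where "a \<in> A" "y = f a" "y \<in> C" by blast
      then show "y \<in> f ` (A \<inter> g ` C)" by (intro image_eqI[of _ f a] IntI image_eqI[of _ g y]) (auto simp: gf)
    next
      fix y assume "y \<in> f ` (A \<inter> g ` C)"
      then obtain c where "g c \<in> A" "c \<in> C" "y = f (g c)" by blast
      then show "y \<in> f ` A \<inter> C" by (auto simp: fg intro: image_eqI[of _ f "g c"])
    qed
    ultimately show "finite (f ` A \<inter> C)" "card (f ` A \<inter> C) \<le> k"
      by (auto intro: order_trans[OF card_image_le])
  qed
  then have "hausdorff_measure (real (CARD('n ranked) - 1)) (f ` A) \<le> of_nat (k * CARD('n ranked))"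
    by (rule hausdorff_measure_k_antichain_le)
  moreover have "hausdorff_measure (real (CARD('n) - 1)) A \<le> hausdorff_measure (real (CARD('n) - 1)) (f ` A)"
    using hausdorff_measure_isometry_image_le[OF dist_g, of "real (CARD('n) - 1)" "f ` A"]
    by (simp add: image_image gf)
  ultimately show ?thesis by (simp add: card_ranked)
qed

end
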